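(* Let $\lambda>-1/2$. If $\lambda\ne\frac12$, then there is a positive constant $C_\lambda$ depending only on $\lambda$ such that for every $f\in L^2(w_\lambda,[-1,1])\cap W_2^1(w_\lambda,[-1,1])$ with $\int_{-1}^1 f(t)w_\lambda(t)\,dt=0$, $$\int_{-1}^1 |f(t)|^2 w_\lambda(t)\,dt \le C_\lambda \int_{-1}^1 (1-t)\left|(-D_\lambda)^{1/2} f(t)\right|^2 w_\lambda(t)\,dt. \qquad ( * )$$ In the case $0\le\lambda\le1$, $\lambda\neq\frac12$, the inequality $( * )$ holds with $$C_\lambda=\frac{8}{(2\lambda-1)^2},$$ and this constant is optimal (smallest possible). The inequality $( * )$ fails when $\lambda=\frac12$ (that is, for $\lambda=\frac12$ it does not hold for all such $f$ with any finite constant).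
   Context: For $\lambda>-1/2$, $w_\lambda(t)=(1-t^2)^{\lambda-1/2}$ on $[-1,1]$. $D_\lambda=(1-t^2)\frac{d^2}{dt^2}-(2\lambda+1)\frac{d}{dt}$, which satisfies $D_\lambda C_n^\lambda=-n(n+2\lambda)C_n^\lambda$ for the Gegenbauer polynomials $C_n^\lambda$, orthogonal with respect to $w_\lambda$ (for $\lambda=0$ they are replaced by the Chebyshev polynomials of the first kind $T_n$). Let $p_n^\lambda$ denote the polynomial of degree $n$, proportional to $C_n^\lambda$, normalized by $c_\lambda\int_{-1}^1 |p_n^\lambda|^2w_\lambda\,dt=1$ with $c_\lambda=1/\int_{-1}^1 w_\lambda(t)\,dt$, and $\widehat f_n^\lambda=c_\lambda\int_{-1}^1 f p_n^\lambda w_\lambda\,dt$. For $r\in\mathbb{R}\setminus\{0\}$, $(-D_\lambda)^r f$ has expansion coefficients $(n(n+2\lambda))^r\widehat f_n^\lambda$ for $n\ge1$ and zero coefficient for $n=0$. $W_2^\alpha(w_\lambda,[-1,1])=\{f\in L^2(w_\lambda,[-1,1]):(-D_\lambda)^{\alpha/2}f\in L^2(w_\lambda,[-1,1])\}$. *)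

theory Defs
  imports "HOL-Analysis.Analysis" "HOL-Computational_Algebra.Polynomial"
begin

definition gegen_weight :: "real \<Rightarrow> real \<Rightarrow> real" where
  "gegen_weight lam t = (1 - t\<^sup>2) powr (lam - 1 / 2)"

fun gegenbauer_poly :: "real \<Rightarrow> nat \<Rightarrow> real poly" where
  "gegenbauer_poly lam 0 = 1"
| "gegenbauer_poly lam (Suc 0) = [:0, 2 * lam:]"
| "gegenbauer_poly lam (Suc (Suc n)) =
     smult (1 / (real n + 2))
       ([:0, 2 * (real n + 1 + lam):] * gegenbauer_poly lam (Suc n)
        - smult (real n + 2 * lam) (gegenbauer_poly lam n))"

fun chebyshev_poly :: "nat \<Rightarrow> real poly" where
  "chebyshev_poly 0 = 1"
| "chebyshev_poly (Suc 0) = [:0, 1:]"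
| "chebyshev_poly (Suc (Suc n)) = [:0, 2:] * chebyshev_poly (Suc n) - chebyshev_poly n"

text \<open>For \<open>lam = 0\<close> the Gegenbauer polynomials of positive degree vanish identically and are
  replaced by the Chebyshev polynomials of the first kind.\<close>

definition gegen_poly :: "real \<Rightarrow> nat \<Rightarrow> real poly" where
  "gegen_poly lam n = (if lam = 0 then chebyshev_poly n else gegenbauer_poly lam n)"

definition gegen_op :: "real \<Rightarrow> real poly \<Rightarrow> real poly" where
  "gegen_op lam p = [:1, 0, -1:] * pderiv (pderiv p) - [:0, 2 * lam + 1:] * pderiv p"

lemma gegenbauer_poly_pderiv:
  "poly (pderiv (gegenbauer_poly lam (Suc n))) x =
     x * poly (pderiv (gegenbauer_poly lam n)) x + (real n + 2 * lam) * poly (gegenbauer_poly lam n) x \<and>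
   x * poly (pderiv (gegenbauer_poly lam (Suc n))) x - poly (pderiv (gegenbauer_poly lam n)) x =
     (real n + 1) * poly (gegenbauer_poly lam (Suc n)) x"
proof (induction n)
  case 0
  show ?case by (simp add: pderiv_pCons)
next
  case (Suc n)
  define a a' b b' c c' where defs: "a = poly (gegenbauer_poly lam n) x"
    "a' = poly (pderiv (gegenbauer_poly lam n)) x"
    "b = poly (gegenbauer_poly lam (Suc n)) x"
    "b' = poly (pderiv (gegenbauer_poly lam (Suc n))) x"
    "c = poly (gegenbauer_poly lam (Suc (Suc n))) x"
    "c' = poly (pderiv (gegenbauer_poly lam (Suc (Suc n)))) x"
  define m where "m = real n + 2"
  have m: "m \<noteq> 0" "real n = m - 2" by (auto simp: m_def)
  have c: "m * c = 2 * (m - 1 + lam) * x * b - (m - 2 + 2 * lam) * a"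
    using m(1) unfolding defs by (simp add: m_def field_simps)
  have c': "m * c' = 2 * (m - 1 + lam) * (b + x * b') - (m - 2 + 2 * lam) * a'"
    using m(1) unfolding defs
    by (simp add: m_def pderiv_smult pderiv_diff pderiv_mult pderiv_pCons field_simps)
  have b': "b' = x * a' + (m - 2 + 2 * lam) * a" "x * b' - a' = (m - 1) * b"
    using Suc.IH unfolding defs m(2) by (simp_all add: algebra_simps)
  have "m * c' = m * (x * b' + (m - 1 + 2 * lam) * b)"
    using c' b'(2) by algebra
  hence 1: "c' = x * b' + (m - 1 + 2 * lam) * b" using m(1) by simp
  have 2: "x * c' - b' = m * c"
    using 1 c b' by algebra
  show ?case using 1 2 unfolding defs m_def by (simp add: algebra_simps)
qed

lemma chebyshev_poly_pderiv:
  "(1 - x\<^sup>2) * poly (pderiv (chebyshev_poly n)) x =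
     real n * (x * poly (chebyshev_poly n) x - poly (chebyshev_poly (Suc n)) x)"
proof (induction n rule: chebyshev_poly.induct)
  case 1
  show ?case by simp
next
  case 2
  show ?case by (simp add: pderiv_pCons power2_eq_square algebra_simps)
next
  case (3 n)
  define a a' b b' c c' where defs: "a = poly (chebyshev_poly n) x"
    "a' = poly (pderiv (chebyshev_poly n)) x"
    "b = poly (chebyshev_poly (Suc n)) x"
    "b' = poly (pderiv (chebyshev_poly (Suc n))) x"
    "c = poly (chebyshev_poly (Suc (Suc n))) x"
    "c' = poly (pderiv (chebyshev_poly (Suc (Suc n)))) x"
  define m where "m = real n"
  have c: "c = 2 * x * b - a" and c': "c' = 2 * b + 2 * x * b' - a'"
    unfolding defs by (simp_all add: pderiv_diff pderiv_mult pderiv_smult pderiv_pCons)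
  have "(1 - x\<^sup>2) * a' = m * (x * a - b)" "(1 - x\<^sup>2) * b' = (m + 1) * (x * b - c)"
    using 3 unfolding defs m_def by (simp_all add: add.commute del: chebyshev_poly.simps)
  hence "(1 - x\<^sup>2) * c' = (m + 2) * (x * c - (2 * x * c - b))"
    using c c' by algebra
  thus ?case unfolding defs m_def by (simp add: algebra_simps)
qed

lemma gegen_op_gegen_poly:
  "gegen_op lam (gegen_poly lam n) = smult (- (real n * (real n + 2 * lam))) (gegen_poly lam n)"
proof (cases "lam = 0")
  case False
  let ?P = "gegenbauer_poly lam"
  have "[:1, 0, -1:] * pderiv (?P n)
          = [:0, real n + 2 * lam:] * ?P n - smult (real n + 1) (?P (Suc n))" (is "?l = ?r")
  proof -
    have "poly ?l x = poly ?r x" for x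
      using gegenbauer_poly_pderiv[of lam n x] by simp algebra
    thus ?thesis by (simp add: poly_eq_poly_eq_iff[symmetric] fun_eq_iff)
  qed
  hence *: "pderiv ?l = pderiv ?r" by simp
  have "poly (gegen_op lam (?P n)) x = poly (smult (- (real n * (real n + 2 * lam))) (?P n)) x" for x
    using arg_cong[OF *, of "\<lambda>p. poly p x"] gegenbauer_poly_pderiv[of lam n x]
    by (simp add: gegen_op_def pderiv_mult pderiv_add pderiv_diff pderiv_minus pderiv_smult pderiv_pCons
             del: gegenbauer_poly.simps) algebra
  thus ?thesis using False
    by (simp add: poly_eq_poly_eq_iff[symmetric] fun_eq_iff gegen_poly_def)
next
  case True
  let ?P = chebyshev_poly
  have "[:1, 0, -1:] * pderiv (?P n) = smult (real n) ([:0, 1:] * ?P n - ?P (Suc n))" (is "?l = ?r")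
  proof -
    have "poly ?l x = poly ?r x" for x
      using chebyshev_poly_pderiv[of x n] by simp algebra
    thus ?thesis by (simp add: poly_eq_poly_eq_iff[symmetric] fun_eq_iff)
  qed
  hence *: "pderiv ?l = pderiv ?r" by simp
  have "[:1, 0, -1:] * smult (real n) (pderiv (?P (Suc n)))
          = [:1, 0, -1:] * smult (real n + 1) ([:0, 1:] * pderiv (?P n) + smult (real n) (?P n))"
    (is "?l' = ?r'")
  proof -
    have "poly ?l' x = poly ?r' x" for x
    proof -
      have "(1 - x\<^sup>2) * poly (pderiv (?P (Suc n))) x
              = (real n + 1) * (poly (?P n) x - x * poly (?P (Suc n)) x)"
        using chebyshev_poly_pderiv[of x "Suc n"] by (simp add: algebra_simps)
      with chebyshev_poly_pderiv[of x n] show ?thesis by simp algebra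
    qed
    thus ?thesis by (intro iffD1[OF poly_eq_poly_eq_iff] ext)
  qed
  hence **: "smult (real n) (pderiv (?P (Suc n)))
               = smult (real n + 1) ([:0, 1:] * pderiv (?P n) + smult (real n) (?P n))"
    by (subst (asm) mult_left_cancel) auto
  have "poly (gegen_op lam (?P n)) x = poly (smult (- (real n * (real n + 2 * lam))) (?P n)) x" for x
    using arg_cong[OF *, of "\<lambda>p. poly p x"] arg_cong[OF **, of "\<lambda>p. poly p x"] True
    by (simp add: gegen_op_def pderiv_mult pderiv_add pderiv_diff pderiv_minus pderiv_smult pderiv_pCons
             del: chebyshev_poly.simps) algebra
  thus ?thesis using True
    by (simp add: poly_eq_poly_eq_iff[symmetric] fun_eq_iff gegen_poly_def)
qed

definition gegen_const :: "real \<Rightarrow> real" where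
  "gegen_const lam = 1 / (LINT t|lebesgue_on {-1..1}. gegen_weight lam t)"

definition orthonormal_gegen_poly :: "real \<Rightarrow> nat \<Rightarrow> real poly" where
  "orthonormal_gegen_poly lam n =
     smult (1 / sqrt (gegen_const lam *
              (LINT t|lebesgue_on {-1..1}. \<bar>poly (gegen_poly lam n) t\<bar>\<^sup>2 * gegen_weight lam t)))
       (gegen_poly lam n)"

text \<open>Elements of \<open>L\<^sup>2\<close> are represented by functions; values outside \<open>[-1,1]\<close> are irrelevant.\<close>

definition L2_gegen :: "real \<Rightarrow> (real \<Rightarrow> complex) set" where
  "L2_gegen lam =
     {f. f \<in> borel_measurable (lebesgue_on {-1..1}) \<and>
         integrable (lebesgue_on {-1..1}) (\<lambda>t. (norm (f t))\<^sup>2 * gegen_weight lam t)}"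

definition gegen_coeff :: "real \<Rightarrow> (real \<Rightarrow> complex) \<Rightarrow> nat \<Rightarrow> complex" where
  "gegen_coeff lam f n =
     of_real (gegen_const lam) *
     (LINT t|lebesgue_on {-1..1}.
        f t * of_real (poly (orthonormal_gegen_poly lam n) t) * of_real (gegen_weight lam t))"

text \<open>\<open>g\<close> is a representative of \<open>(-D)\<^sup>r f\<close> in \<open>L\<^sup>2\<close>, where \<open>D\<close> is \<^const>\<open>gegen_op\<close>. Its expansion
  coefficients determine \<open>g\<close> only up to null sets, hence a relation instead of a function.\<close>

definition is_neg_gegen_op_powr ::
  "real \<Rightarrow> real \<Rightarrow> (real \<Rightarrow> complex) \<Rightarrow> (real \<Rightarrow> complex) \<Rightarrow> bool" where
  "is_neg_gegen_op_powr lam r f g \<longleftrightarrow>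
     g \<in> L2_gegen lam \<and> gegen_coeff lam g 0 = 0 \<and>
     (\<forall>n\<ge>1. gegen_coeff lam g n =
        of_real ((real n * (real n + 2 * lam)) powr r) * gegen_coeff lam f n)"

definition W2_gegen :: "real \<Rightarrow> real \<Rightarrow> (real \<Rightarrow> complex) set" where
  "W2_gegen lam \<alpha> = {f \<in> L2_gegen lam. \<exists>g. is_neg_gegen_op_powr lam (\<alpha> / 2) f g}"

definition gegen_ineq :: "real \<Rightarrow> real \<Rightarrow> bool" where
  "gegen_ineq lam C \<longleftrightarrow>
     (\<forall>f g. f \<in> L2_gegen lam \<inter> W2_gegen lam 1 \<longrightarrow>
        (LINT t|lebesgue_on {-1..1}. f t * of_real (gegen_weight lam t)) = 0 \<longrightarrow>
        is_neg_gegen_op_powr lam (1 / 2) f g \<longrightarrow>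
        (LINT t|lebesgue_on {-1..1}. (norm (f t))\<^sup>2 * gegen_weight lam t)
          \<le> C * (LINT t|lebesgue_on {-1..1}. (1 - t) * (norm (g t))\<^sup>2 * gegen_weight lam t))"

end

theory Submission
  imports Defs
begin

text \<open>
  Expand \<open>f\<close> and \<open>g = (-D)\<^sup>1\<^sup>/\<^sup>2 f\<close> in the orthonormal polynomials \<open>p\<^sub>n\<close>; the vanishing mean of \<open>f\<close>
  removes the index \<open>0\<close>. Real and imaginary parts can be treated separately, so let \<open>f\<close> and \<open>g\<close> be
  real. With \<open>b\<^sub>n\<close> the coefficients of \<open>g\<close>, the left-hand side is the sum of
  \<open>b\<^sub>n\<^sup>2 / (n (n + 2 \<lambda>))\<close>. On the right-hand side, multiplication by \<open>t\<close> is a Jacobi matrix with zero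
  diagonal and off-diagonal entries \<open>\<alpha>\<^sub>n\<close>, so the integral of \<open>(1 - t) g\<^sup>2\<close> is the quadratic form
  \<open>\<Sum> b\<^sub>n\<^sup>2 - 2 \<Sum> \<alpha>\<^sub>n b\<^sub>n b\<^sub>n\<^sub>+\<^sub>1\<close>. The claim is thus a discrete Hardy inequality
  (\<open>jacobi_hardy\<close>), and the two statements are equivalent for nonnegative constants:
  test polynomials give one direction (\<open>gegen_ineq_imp_jacobi_hardy\<close>), completeness of the
  polynomials gives the other (\<open>jacobi_hardy_imp_gegen_ineq\<close>, resting on
  \<open>gegen_expansion_converges\<close>).

  For the positive results each cross term is absorbed by a weighted arithmetic-geometric mean,
  \<open>2 \<alpha>\<^sub>n b\<^sub>n b\<^sub>n\<^sub>+\<^sub>1 \<le> \<kappa>\<^sub>n b\<^sub>n\<^sup>2 + (\<alpha>\<^sub>n\<^sup>2 / \<kappa>\<^sub>n) b\<^sub>n\<^sub>+\<^sub>1\<^sup>2\<close>. In the variable \<open>x = n + \<lambda>\<close> the choice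
  \<open>\<kappa>\<^sub>n = (x + 1/2) / (2 x)\<close> leaves, for \<open>n \<ge> 2\<close>, exactly the potential
  \<open>(\<lambda> - 1/2)\<^sup>2 / (2 x (x - 1/2))\<close>. For \<open>0 \<le> \<lambda> \<le> 1\<close> one has
  \<open>x (x - 1/2) \<le> x\<^sup>2 - \<lambda>\<^sup>2 = n (n + 2 \<lambda>)\<close> because \<open>x \<ge> 1 + \<lambda> \<ge> 2 \<lambda>\<^sup>2\<close>, which gives the constant
  \<open>2 / (\<lambda> - 1/2)\<^sup>2 = 8 / (2 \<lambda> - 1)\<^sup>2\<close>; for other \<open>\<lambda>\<close> the two quantities are still comparable.

  Optimality and the failure at \<open>\<lambda> = 1/2\<close> both follow from \<open>C (2 \<lambda> - 1)\<^sup>2 \<ge> 8\<close>, which holds for every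
  admissible constant \<open>C\<close> when \<open>0 \<le> \<lambda> \<le> 1\<close> (\<open>jacobi_hardy_constant_lower_bound\<close>). The critical
  growth is \<open>b\<^sub>n = \<surd>(n + \<lambda>)\<close>, for which the Hardy sum diverges logarithmically while the quadratic
  form exceeds \<open>(\<lambda> - 1/2)\<^sup>2 / 2\<close> times the Hardy sum by a bounded amount only; a logarithmic cutoff
  makes the sequences finite at bounded cost.
\<close>

section \<open>Density of the polynomials in weighted square-integrable functions\<close>

definition square_integrable :: "'a measure \<Rightarrow> ('a \<Rightarrow> real) \<Rightarrow> bool" where
  "square_integrable M f \<longleftrightarrow> f \<in> borel_measurable M \<and> integrable M (\<lambda>x. (f x)\<^sup>2)"

lemma square_integrable_mult:
  assumes "square_integrable M f" "square_integrable M g"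
  shows "integrable M (\<lambda>x. f x * g x)"
proof (rule Bochner_Integration.integrable_bound)
  show "integrable M (\<lambda>x. (f x)\<^sup>2 + (g x)\<^sup>2)"
    using assms by (auto simp: square_integrable_def)
  show "(\<lambda>x. f x * g x) \<in> borel_measurable M"
    using assms by (auto simp: square_integrable_def)
  have "\<bar>a * b\<bar> \<le> a\<^sup>2 + b\<^sup>2" for a b :: real
  proof -
    have "0 \<le> \<bar>a\<bar> * \<bar>b\<bar>" by simp
    then show ?thesis
      using sum_squares_bound[of "\<bar>a\<bar>" "\<bar>b\<bar>"] unfolding abs_mult power2_abs by linarith
  qed
  then show "AE x in M. norm (f x * g x) \<le> norm ((f x)\<^sup>2 + (g x)\<^sup>2)"
    by simp
qed

lemma square_integrable_cmult: "square_integrable M f \<Longrightarrow> square_integrable M (\<lambda>x. c * f x)"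
  by (auto simp: square_integrable_def power_mult_distrib)

lemma square_integrable_add:
  assumes "square_integrable M f" "square_integrable M g"
  shows "square_integrable M (\<lambda>x. f x + g x)"
  using assms square_integrable_mult[OF assms]
  by (auto simp: square_integrable_def power2_sum mult.assoc)

lemma square_integrable_diff:
  assumes "square_integrable M f" "square_integrable M g"
  shows "square_integrable M (\<lambda>x. f x - g x)"
  using square_integrable_add[OF assms(1) square_integrable_cmult[OF assms(2), of "-1"]] by simp

lemma square_integrable_bounded_mult:
  assumes "square_integrable M f" "h \<in> borel_measurable M" "\<And>x. x \<in> space M \<Longrightarrow> \<bar>h x\<bar> \<le> B"
  shows "integrable M (\<lambda>x. h x * (f x)\<^sup>2)"
proof (rule Bochner_Integration.integrable_bound)
  show "integrable M (\<lambda>x. B * (f x)\<^sup>2)" using assms(1) by (auto simp: square_integrable_def)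
  show "(\<lambda>x. h x * (f x)\<^sup>2) \<in> borel_measurable M"
    using assms by (auto simp: square_integrable_def)
  show "AE x in M. norm (h x * (f x)\<^sup>2) \<le> norm (B * (f x)\<^sup>2)"
  proof (rule AE_I2)
    fix x assume "x \<in> space M"
    then have "\<bar>h x\<bar> \<le> \<bar>B\<bar>" using assms(3)[of x] by linarith
    then show "norm (h x * (f x)\<^sup>2) \<le> norm (B * (f x)\<^sup>2)"
      by (auto simp: abs_mult intro!: mult_right_mono)
  qed
qed

lemma integral_truncation_tendsto_0:
  assumes "square_integrable M f"
  shows "(\<lambda>k. LINT x|M. (f x - max (- real k) (min (real k) (f x)))\<^sup>2) \<longlonglongrightarrow> 0"
proof -
  have [measurable]: "f \<in> borel_measurable M" using assms by (simp add: square_integrable_def)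
  have "(\<lambda>k. LINT x|M. (f x - max (- real k) (min (real k) (f x)))\<^sup>2) \<longlonglongrightarrow> (LINT x|M. 0)"
  proof (rule integral_dominated_convergence[where w = "\<lambda>x. (f x)\<^sup>2"])
    show "AE x in M. (\<lambda>k. (f x - max (- real k) (min (real k) (f x)))\<^sup>2) \<longlonglongrightarrow> 0"
    proof (rule AE_I2)
      fix x
      have "eventually (\<lambda>k. real k \<ge> \<bar>f x\<bar>) sequentially"
        using filterlim_real_sequentially by (simp add: filterlim_at_top)
      then have "eventually (\<lambda>k. (f x - max (- real k) (min (real k) (f x)))\<^sup>2 = 0) sequentially"
        by eventually_elim (auto simp: max_def min_def)
      then show "(\<lambda>k. (f x - max (- real k) (min (real k) (f x)))\<^sup>2) \<longlonglongrightarrow> 0"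
        by (rule tendsto_eventually)
    qed
    have *: "\<bar>y - max (- real k) (min (real k) y)\<bar> \<le> \<bar>y\<bar>" for k and y :: real
      by (auto simp: max_def min_def)
    show "AE x in M. norm ((f x - max (- real k) (min (real k) (f x)))\<^sup>2) \<le> (f x)\<^sup>2" for k
    proof (rule AE_I2)
      fix x show "norm ((f x - max (- real k) (min (real k) (f x)))\<^sup>2) \<le> (f x)\<^sup>2"
        using *[of "f x" k] by (simp add: abs_le_square_iff)
    qed
  qed (use assms in \<open>auto simp: square_integrable_def\<close>)
  then show ?thesis by simp
qed

text \<open>
  The approximation proceeds in three steps: truncate \<open>f\<close> to a bounded function; approximate that one
  almost everywhere by continuous functions, which Lebesgue measurability provides and which may be
  truncated at the same level, so that dominated convergence applies; approximate a continuous
  function uniformly by a polynomial. Each step costs less than \<open>e / 9\<close>, and squaring a sum of three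
  terms costs a factor \<open>3\<close>.
\<close>

lemma polynomials_dense_L2:
  fixes w f :: "real \<Rightarrow> real" and a b :: real
  defines "M \<equiv> density (lebesgue_on {a..b}) w"
  assumes w: "integrable (lebesgue_on {a..b}) w" "\<And>t. 0 \<le> w t"
    and f: "square_integrable M f" and e: "e > 0"
  obtains q :: "real poly" where "(LINT t|M. (f t - poly q t)\<^sup>2) < e"
proof -
  have [measurable]: "w \<in> borel_measurable (lebesgue_on {a..b})" using w by auto
  have spM: "space M = {a..b}" by (simp add: M_def)
  have setsM: "measurable M borel = measurable (lebesgue_on {a..b}) borel"
    by (rule measurable_cong_sets) (auto simp: M_def)
  have fin: "finite_measure M"
  proof (rule finite_measureI)
    have "emeasure M (space M) = (\<integral>\<^sup>+x. ennreal (w x) \<partial>lebesgue_on {a..b})"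
      unfolding M_def by (subst emeasure_density) (auto intro!: nn_integral_cong)
    also have "\<dots> < \<infinity>" using w by (simp add: integrable_iff_bounded)
    finally show "emeasure M (space M) \<noteq> \<infinity>" by simp
  qed
  interpret finite_measure M by fact
  have [measurable]: "f \<in> borel_measurable M" using f by (simp add: square_integrable_def)
  have bdd: "square_integrable M h" if "h \<in> borel_measurable M" "\<And>x. x \<in> {a..b} \<Longrightarrow> \<bar>h x\<bar> \<le> B" for h B
  proof -
    have "\<bar>h x\<bar> \<le> \<bar>B\<bar>" if "x \<in> {a..b}" for x using \<open>x \<in> {a..b} \<Longrightarrow> \<bar>h x\<bar> \<le> B\<close> that by fastforce
    then have "AE x in M. norm ((h x)\<^sup>2) \<le> B\<^sup>2"
      by (intro AE_I2) (simp add: spM abs_le_square_iff)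
    moreover have "(\<lambda>x. (h x)\<^sup>2) \<in> borel_measurable M" using that(1) by simp
    ultimately have "integrable M (\<lambda>x. (h x)\<^sup>2)"
      by (rule integrable_const_bound)
    then show ?thesis using that(1) by (auto simp: square_integrable_def)
  qed
  have bdd_cont: "square_integrable M h" if "continuous_on {a..b} h" for h
  proof -
    have "bounded (h ` {a..b})"
      using that by (intro compact_imp_bounded compact_continuous_image) auto
    then obtain B where "\<forall>x\<in>{a..b}. \<bar>h x\<bar> \<le> B" by (auto simp: bounded_iff)
    moreover have "h \<in> borel_measurable M"
      unfolding setsM by (rule continuous_imp_measurable_on_sets_lebesgue[OF that]) auto
    ultimately show ?thesis by (intro bdd[of h B]) auto
  qed
  have e9: "e / 9 > 0" using e by simp
  obtain k where k: "(LINT x|M. (f x - max (- real k) (min (real k) (f x)))\<^sup>2) < e / 9"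
    using eventually_happens'[OF sequentially_bot order_tendstoD(2)[OF integral_truncation_tendsto_0[OF f] e9]]
    by blast
  define cl where "cl y = max (- real k) (min (real k) y)" for y
  define h where "h x = cl (f x)" for x
  have clb: "\<bar>cl y\<bar> \<le> real k" for y by (auto simp: cl_def max_def min_def)
  have clc: "continuous_on A cl" for A unfolding cl_def by (intro continuous_intros)
  have [measurable]: "cl \<in> borel_measurable borel"
    by (rule borel_measurable_continuous_onI[OF clc])
  have hM[measurable]: "h \<in> borel_measurable M" unfolding h_def by measurable
  have hL: "h \<in> borel_measurable (lebesgue_on {a..b})" using hM by (simp only: setsM)
  have "h measurable_on {a..b}"
    using hL by (simp add: measurable_on_iff_borel_measurable)
  then obtain N g where N: "negligible N" and g: "\<And>n. continuous_on UNIV (g n)"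
    and lim: "\<And>x. x \<notin> N \<Longrightarrow> (\<lambda>n. g n x) \<longlonglongrightarrow> (if x \<in> {a..b} then h x else 0)"
    unfolding measurable_on_def by blast
  have gc: "continuous_on {a..b} (\<lambda>x. cl (g n x))" for n
    by (rule continuous_on_compose2[OF clc continuous_on_subset[OF g]]) auto
  have gM: "(\<lambda>x. cl (g n x)) \<in> borel_measurable M" for n
    using bdd_cont[OF gc] by (simp add: square_integrable_def)
  have AE: "AE x in M. x \<notin> N"
  proof -
    have "AE x in lebesgue. x \<notin> N"
      using N by (intro AE_not_in) (simp add: negligible_iff_null_sets)
    then have "AE x in lebesgue_on {a..b}. x \<notin> N"
      by (subst AE_restrict_space_iff) auto
    then show ?thesis unfolding M_def by (subst AE_density) auto
  qed
  have "(\<lambda>n. LINT x|M. (h x - cl (g n x))\<^sup>2) \<longlonglongrightarrow> (LINT x|M. 0)"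
  proof (rule integral_dominated_convergence[where w = "\<lambda>x. (2 * real k)\<^sup>2"])
    show "AE x in M. (\<lambda>n. (h x - cl (g n x))\<^sup>2) \<longlonglongrightarrow> 0"
      using AE AE_space
    proof eventually_elim
      case (elim x)
      then have "(\<lambda>n. g n x) \<longlonglongrightarrow> h x" using lim[of x] by (simp add: spM)
      then have "(\<lambda>n. cl (g n x)) \<longlonglongrightarrow> cl (h x)"
        using clc[of UNIV] by (auto simp: continuous_on_eq_continuous_at intro: isCont_tendsto_compose)
      moreover have "cl (h x) = h x" by (auto simp: h_def cl_def max_def min_def)
      ultimately have "(\<lambda>n. (h x - cl (g n x))\<^sup>2) \<longlonglongrightarrow> (h x - h x)\<^sup>2"
        by (intro tendsto_intros) simp
      then show ?case by simp
    qed
    show "AE x in M. norm ((h x - cl (g n x))\<^sup>2) \<le> (2 * real k)\<^sup>2" for n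
    proof (rule AE_I2)
      fix x
      have "\<bar>h x - cl (g n x)\<bar> \<le> \<bar>2 * real k\<bar>" using clb[of "f x"] clb[of "g n x"] by (simp add: h_def)
      then show "norm ((h x - cl (g n x))\<^sup>2) \<le> (2 * real k)\<^sup>2"
        by (simp only: abs_le_square_iff real_norm_def abs_power2)
    qed
  qed (use gM in auto)
  then have lim0: "(\<lambda>n. LINT x|M. (h x - cl (g n x))\<^sup>2) \<longlonglongrightarrow> 0" by simp
  obtain n where n: "(LINT x|M. (h x - cl (g n x))\<^sup>2) < e / 9"
    using eventually_happens'[OF sequentially_bot order_tendstoD(2)[OF lim0 e9]] by blast
  define u where "u x = cl (g n x)" for x
  define m where "m = measure M (space M) + 1"
  have m: "m > 0" by (simp add: m_def add_nonneg_pos)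
  \<comment> \<open>The summand \<open>1\<close> in \<open>m\<close> avoids a division by zero for the null measure.\<close>
  define d where "d = sqrt (e / (9 * m))"
  have d: "d > 0" "d\<^sup>2 * m = e / 9" using e m by (auto simp: d_def)
  obtain p where p: "real_polynomial_function p" "\<And>x. x \<in> {a..b} \<Longrightarrow> \<bar>u x - p x\<bar> < d"
    using Stone_Weierstrass_real_polynomial_function[OF compact_Icc gc d(1)] unfolding u_def by blast
  obtain c j where cj: "p = (\<lambda>x. \<Sum>i\<le>(j::nat). c i * x ^ i)"
    using p(1) real_polynomial_function_iff_sum by blast
  define q where "q = (\<Sum>i\<le>j. monom (c i) i)"
  have pq: "p = poly q" unfolding cj q_def by (auto simp: poly_sum poly_monom)
  have q2: "square_integrable M (poly q)" by (intro bdd_cont continuous_intros)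
  have u2: "square_integrable M u" unfolding u_def by (rule bdd_cont[OF gc])
  have h2: "square_integrable M h" by (rule bdd[of h "real k"]) (auto simp: h_def clb)
  have d1: "integrable M (\<lambda>x. (f x - h x)\<^sup>2)" and d2: "integrable M (\<lambda>x. (h x - u x)\<^sup>2)"
    and d3: "integrable M (\<lambda>x. (u x - poly q x)\<^sup>2)" and d4: "integrable M (\<lambda>x. (f x - poly q x)\<^sup>2)"
    using square_integrable_diff[OF f h2] square_integrable_diff[OF h2 u2]
      square_integrable_diff[OF u2 q2] square_integrable_diff[OF f q2]
    by (auto simp: square_integrable_def)
  have "(LINT x|M. (u x - poly q x)\<^sup>2) \<le> (LINT x|M. d\<^sup>2)"
  proof (rule integral_mono[OF d3])
    fix x assume "x \<in> space M"
    then have "\<bar>u x - poly q x\<bar> \<le> \<bar>d\<bar>" using p(2)[of x] d(1) by (simp add: spM pq)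
    then show "(u x - poly q x)\<^sup>2 \<le> d\<^sup>2" by (simp add: abs_le_square_iff)
  qed auto
  also have "\<dots> = d\<^sup>2 * measure M (space M)" by simp
  also have "\<dots> \<le> d\<^sup>2 * m" unfolding m_def by (intro mult_left_mono) auto
  finally have I3: "(LINT x|M. (u x - poly q x)\<^sup>2) \<le> e / 9" using d by simp
  have sq3: "(y1 + y2 + y3)\<^sup>2 \<le> 3 * (y1\<^sup>2 + y2\<^sup>2 + y3\<^sup>2)" for y1 y2 y3 :: real
    using zero_le_power2[of "y1 - y2"] zero_le_power2[of "y2 - y3"] zero_le_power2[of "y1 - y3"]
    by (simp add: power2_eq_square algebra_simps)
  have "(LINT x|M. (f x - poly q x)\<^sup>2)
      \<le> (LINT x|M. 3 * ((f x - h x)\<^sup>2 + (h x - u x)\<^sup>2 + (u x - poly q x)\<^sup>2))"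
  proof (rule integral_mono[OF d4])
    show "(f x - poly q x)\<^sup>2 \<le> 3 * ((f x - h x)\<^sup>2 + (h x - u x)\<^sup>2 + (u x - poly q x)\<^sup>2)" for x
      using sq3[of "f x - h x" "h x - u x" "u x - poly q x"] by simp
  qed (use d1 d2 d3 in auto)
  also have "\<dots> = 3 * ((LINT x|M. (f x - h x)\<^sup>2) + (LINT x|M. (h x - u x)\<^sup>2) + (LINT x|M. (u x - poly q x)\<^sup>2))"
    using d1 d2 d3 by simp
  also have "\<dots> < e"
    using k n I3 by (simp add: h_def u_def cl_def)
  finally show thesis by (rule that)
qed

section \<open>The normalized Gegenbauer measure\<close>

text \<open>
  The substitution \<open>t = 2 s - 1\<close> turns the total mass into a multiple of a Beta integral.
\<close>

lemma gegen_weight_integrable: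
  assumes "lam > - 1 / 2"
  shows "integrable (lebesgue_on {-1..1}) (gegen_weight lam)"
    and "(LINT t|lebesgue_on {-1..1}. gegen_weight lam t) > 0"
proof -
  define a where "a = lam + 1 / 2"
  have a: "a > 0" using assms by (simp add: a_def)
  have "((\<lambda>t. (t / 2 + 1 / 2) powr (a - 1) * (1 - (t / 2 + 1 / 2)) powr (a - 1)) has_integral 2 * Beta a a)
          {-1..1}"
    using has_integral_affinity'[of "\<lambda>t. t powr (a - 1) * (1 - t) powr (a - 1)" "Beta a a" 0 1 "1/2" "1/2"]
      has_integral_Beta_real[OF a a] by (simp add: mult.commute)
  then have "((\<lambda>t. 4 powr (a - 1) * ((t / 2 + 1 / 2) powr (a - 1) * (1 - (t / 2 + 1 / 2)) powr (a - 1)))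
      has_integral 4 powr (a - 1) * (2 * Beta a a)) {-1..1}"
    by (rule has_integral_mult_right)
  then have int: "(gegen_weight lam has_integral 4 powr (a - 1) * (2 * Beta a a)) {-1..1}"
  proof (rule has_integral_eq[rotated])
    fix t :: real assume t: "t \<in> {-1..1}"
    have "4 powr (a - 1) * ((t / 2 + 1 / 2) powr (a - 1) * (1 - (t / 2 + 1 / 2)) powr (a - 1))
        = (4 * ((t / 2 + 1 / 2) * (1 - (t / 2 + 1 / 2)))) powr (a - 1)"
      using t by (simp add: powr_mult)
    also have "4 * ((t / 2 + 1 / 2) * (1 - (t / 2 + 1 / 2))) = 1 - t\<^sup>2"
      by (simp add: power2_eq_square field_simps)
    finally show "4 powr (a - 1) * ((t / 2 + 1 / 2) powr (a - 1) * (1 - (t / 2 + 1 / 2)) powr (a - 1))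
        = gegen_weight lam t" by (simp add: gegen_weight_def a_def)
  qed
  have "gegen_weight lam absolutely_integrable_on {-1..1}"
    by (rule nonnegative_absolutely_integrable_1)
       (use int in \<open>auto simp: gegen_weight_def has_integral_integrable\<close>)
  then show 1: "integrable (lebesgue_on {-1..1}) (gegen_weight lam)"
    by (simp add: set_integrable_def integrable_restrict_space)
  have "Beta a a > 0" using a by (simp add: Beta_def)
  then show "(LINT t|lebesgue_on {-1..1}. gegen_weight lam t) > 0"
    using lebesgue_integral_eq_integral[OF 1] integral_unique[OF int] by simp
qed

text \<open>
  Including the constant \<open>c\<^sub>\<lambda>\<close> makes this a probability measure, so that the normalization of the
  orthonormal polynomials and the definition of the coefficients become plain integrals.
\<close>

definition gegen_measure :: "real \<Rightarrow> real measure" where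
  "gegen_measure lam = density (lebesgue_on {-1..1}) (\<lambda>t. gegen_const lam * gegen_weight lam t)"

lemma gegen_const_pos: "lam > - 1 / 2 \<Longrightarrow> gegen_const lam > 0"
  using gegen_weight_integrable(2)[of lam] by (simp add: gegen_const_def)

lemma gegen_weight_nonneg: "gegen_weight lam t \<ge> 0"
  by (simp add: gegen_weight_def add.commute)

lemma gegen_measure_measurable:
  "borel_measurable (gegen_measure lam) = borel_measurable (lebesgue_on {-1..1})"
  by (rule measurable_cong_sets) (auto simp: gegen_measure_def)

lemma space_gegen_measure: "space (gegen_measure lam) = {-1..1}"
  by (simp add: gegen_measure_def)

lemma gegen_measure_integral:
  fixes f :: "real \<Rightarrow> 'b::{banach, second_countable_topology, real_normed_field}"
  assumes lam: "lam > - 1 / 2" and f: "f \<in> borel_measurable (lebesgue_on {-1..1})"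
  shows "integrable (gegen_measure lam) f \<longleftrightarrow>
           integrable (lebesgue_on {-1..1}) (\<lambda>t. f t * of_real (gegen_weight lam t))" (is ?A)
    and "integral\<^sup>L (gegen_measure lam) f =
           of_real (gegen_const lam) * (LINT t|lebesgue_on {-1..1}. f t * of_real (gegen_weight lam t))" (is ?B)
proof -
  have [measurable]: "gegen_weight lam \<in> borel_measurable (lebesgue_on {-1..1})"
    using gegen_weight_integrable(1)[OF lam] by auto
  have c: "gegen_const lam > 0" using gegen_const_pos[OF lam] .
  have eq: "(gegen_const lam * gegen_weight lam t) *\<^sub>R f t
      = of_real (gegen_const lam) * (f t * of_real (gegen_weight lam t))" for t
    by (simp add: scaleR_conv_of_real)
  have AE: "AE t in lebesgue_on {-1..1}. 0 \<le> gegen_const lam * gegen_weight lam t"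
    using c by (simp add: gegen_weight_nonneg)
  show ?A unfolding gegen_measure_def
  proof (subst integrable_density[OF f _ AE])
    let ?h = "\<lambda>t. f t * of_real (gegen_weight lam t)"
    have "integrable (lebesgue_on {-1..1}) ?h"
      if "integrable (lebesgue_on {-1..1}) (\<lambda>t. of_real (gegen_const lam) * ?h t)"
      using integrable_mult_right[OF that, of "of_real (1 / gegen_const lam)"] c
      by (simp flip: mult.assoc of_real_mult)
    then show "integrable (lebesgue_on {-1..1}) (\<lambda>t. (gegen_const lam * gegen_weight lam t) *\<^sub>R f t)
        = integrable (lebesgue_on {-1..1}) ?h"
      unfolding eq using integrable_mult_right by blast
  qed measurable
  show ?B unfolding gegen_measure_def
    by (subst integral_density[OF f _ AE]) (auto simp: eq)
qed

lemma gegen_measure_continuous: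
  assumes lam: "lam > - 1 / 2" and f: "continuous_on {-1..1} f"
  shows "integrable (gegen_measure lam) (f :: real \<Rightarrow> real)" "square_integrable (gegen_measure lam) f"
proof -
  have *: "integrable (gegen_measure lam) f" "f \<in> borel_measurable (gegen_measure lam)"
    if "continuous_on {-1..1} f" for f :: "real \<Rightarrow> real"
  proof -
    have fm: "f \<in> borel_measurable (lebesgue_on {-1..1})"
      by (rule continuous_imp_measurable_on_sets_lebesgue[OF that]) auto
    then show fm': "f \<in> borel_measurable (gegen_measure lam)" by (simp add: gegen_measure_measurable)
    have "bounded (f ` {-1..1})"
      using that by (intro compact_imp_bounded compact_continuous_image) auto
    then obtain B where B: "\<forall>x\<in>{-1..1}. \<bar>f x\<bar> \<le> B" by (auto simp: bounded_iff)
    have "integrable (gegen_measure lam) (\<lambda>_. 1 :: real)"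
      using gegen_measure_integral(1)[OF lam, of "\<lambda>_. 1 :: real"] gegen_weight_integrable(1)[OF lam] by simp
    then have "integrable (gegen_measure lam) (\<lambda>_. B * 1)" by (rule integrable_mult_right)
    then show "integrable (gegen_measure lam) f"
    proof (rule Bochner_Integration.integrable_bound[OF _ fm'])
      have "\<bar>f x\<bar> \<le> \<bar>B\<bar>" if "x \<in> {-1..1}" for x using B that by fastforce
      then show "AE x in gegen_measure lam. norm (f x) \<le> norm (B * 1)"
        by (intro AE_I2) (simp add: space_gegen_measure)
    qed
  qed
  show "integrable (gegen_measure lam) f" by (rule *[OF f])
  show "square_integrable (gegen_measure lam) f"
    using *(2)[OF f] *(1)[OF continuous_on_power[OF f, of 2]] by (simp add: square_integrable_def)
qed

lemma gegen_measure_total: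
  assumes lam: "lam > - 1 / 2"
  shows "(LINT t|gegen_measure lam. 1) = (1 :: real)"
  using gegen_measure_integral(2)[OF lam, of "\<lambda>_. 1 :: real"] gegen_weight_integrable(2)[OF lam]
  by (simp add: gegen_const_def)

lemma square_integrable_poly: "lam > - 1 / 2 \<Longrightarrow> square_integrable (gegen_measure lam) (poly p)"
  by (rule gegen_measure_continuous) (auto intro!: continuous_intros)

text \<open>
  Green's formula: with \<open>W = (1 - t\<^sup>2)\<close> to the power \<open>\<lambda> + 1/2\<close>, the function \<open>(D p) q - p (D q)\<close> times
  the weight is the derivative of \<open>W (p' q - p q')\<close>, and \<open>W\<close> vanishes at both end points.
\<close>

lemma gegen_op_self_adjoint:
  assumes lam: "lam > - 1 / 2"
  shows "(LINT t|gegen_measure lam. poly (gegen_op lam p) t * poly q t)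
       = (LINT t|gegen_measure lam. poly p t * poly (gegen_op lam q) t)"
proof -
  define r where "r = pderiv p * q - p * pderiv q"
  define s where "s = gegen_op lam p * q - p * gegen_op lam q"
  define F where "F t = (1 - t\<^sup>2) powr (lam + 1 / 2) * poly r t" for t
  have "((\<lambda>t. poly s t * gegen_weight lam t) has_integral (F 1 - F (-1))) {-1..1}"
  proof (rule fundamental_theorem_of_calculus_interior)
    have "continuous_on {-1..1} (\<lambda>t::real. (1 - t\<^sup>2) powr (lam + 1 / 2))"
    proof (rule continuous_on_powr')
      have "0 \<le> 1 - x\<^sup>2" if "x \<in> {-1..1}" for x :: real
        using abs_square_le_1[of x] that by auto
      then show "\<forall>x\<in>{-1..1::real}. 0 \<le> 1 - x\<^sup>2 \<and> (1 - x\<^sup>2 = 0 \<longrightarrow> 0 < lam + 1 / 2)"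
        using lam by auto
    qed (auto intro!: continuous_intros)
    then show "continuous_on {-1..1} F" unfolding F_def
      by (rule continuous_on_mult) (intro continuous_intros)
    fix t :: real assume "t \<in> {-1<..<1}"
    then have t: "1 - t\<^sup>2 > 0" using abs_square_less_1[of t] by auto
    have w: "(1 - t\<^sup>2) powr (lam + 1 / 2) = (1 - t\<^sup>2) * gegen_weight lam t"
      using t powr_add[of "1 - t\<^sup>2" 1 "lam - 1 / 2"] by (simp add: gegen_weight_def add.commute)
    have "((\<lambda>t. 1 - t\<^sup>2) has_real_derivative - 2 * t) (at t)"
      by (rule derivative_eq_intros refl | simp)+
    from DERIV_fun_powr[OF this t, of "lam + 1 / 2"]
    have "((\<lambda>t. (1 - t\<^sup>2) powr (lam + 1 / 2)) has_real_derivative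
        (lam + 1 / 2) * gegen_weight lam t * (- 2 * t)) (at t)"
      by (simp add: gegen_weight_def add.commute)
    from DERIV_mult[OF this poly_DERIV[of r t]]
    have "(F has_real_derivative
        ((lam + 1 / 2) * gegen_weight lam t * (- 2 * t) * poly r t
           + poly (pderiv r) t * (1 - t\<^sup>2) powr (lam + 1 / 2))) (at t)"
      unfolding F_def .
    also have "(lam + 1 / 2) * gegen_weight lam t * (- 2 * t) * poly r t
           + poly (pderiv r) t * (1 - t\<^sup>2) powr (lam + 1 / 2) = poly s t * gegen_weight lam t"
      unfolding w s_def r_def gegen_op_def
      by (simp add: pderiv_diff pderiv_mult power2_eq_square algebra_simps)
    finally show "(F has_vector_derivative poly s t * gegen_weight lam t) (at t)"
      by (simp add: has_real_derivative_iff_has_vector_derivative)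
  qed simp
  then have *: "((\<lambda>t. poly s t * gegen_weight lam t) has_integral 0) {-1..1}"
    using lam by (simp add: F_def)
  have int: "integrable (gegen_measure lam) (poly p')" for p'
    by (rule gegen_measure_continuous[OF lam]) (auto intro!: continuous_intros)
  have int2: "integrable (gegen_measure lam) (\<lambda>t. poly p' t * poly q' t)" for p' q'
    by (rule gegen_measure_continuous[OF lam]) (auto intro!: continuous_intros)
  have m: "poly s \<in> borel_measurable (lebesgue_on {-1..1})"
    by (rule continuous_imp_measurable_on_sets_lebesgue) (auto intro!: continuous_intros)
  have "integrable (lebesgue_on {-1..1}) (\<lambda>t. poly s t * gegen_weight lam t)"
    using int[of s] gegen_measure_integral(1)[OF lam m] by simp
  then have "(LINT t|lebesgue_on {-1..1}. poly s t * gegen_weight lam t) = 0"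
    using lebesgue_integral_eq_integral[of "{-1..1}" "\<lambda>t. poly s t * gegen_weight lam t"] integral_unique[OF *]
    by simp
  then have "(LINT t|gegen_measure lam. poly s t) = 0"
    using gegen_measure_integral(2)[OF lam m] by simp
  moreover have "(LINT t|gegen_measure lam. poly s t)
      = (LINT t|gegen_measure lam. poly (gegen_op lam p) t * poly q t)
       - (LINT t|gegen_measure lam. poly p t * poly (gegen_op lam q) t)"
    using int2 by (simp add: s_def)
  ultimately show ?thesis by simp
qed

section \<open>Recurrence and Jacobi matrix of the orthonormal polynomials\<close>

definition gegen_mean :: "real \<Rightarrow> real poly \<Rightarrow> real" where
  "gegen_mean lam p = (LINT t|gegen_measure lam. poly p t)"

lemma integrable_poly_gegen_measure: "lam > - 1 / 2 \<Longrightarrow> integrable (gegen_measure lam) (poly p)"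
  by (rule gegen_measure_continuous) (auto intro!: continuous_intros)

lemma gegen_mean_linear:
  assumes "lam > - 1 / 2"
  shows "gegen_mean lam (p + q) = gegen_mean lam p + gegen_mean lam q"
    and "gegen_mean lam (p - q) = gegen_mean lam p - gegen_mean lam q"
    and "gegen_mean lam (- p) = - gegen_mean lam p"
    and "gegen_mean lam (smult c p) = c * gegen_mean lam p"
  using integrable_poly_gegen_measure[OF assms, of p] integrable_poly_gegen_measure[OF assms, of q]
  by (simp_all add: gegen_mean_def poly_add[abs_def] poly_diff[abs_def] poly_minus[abs_def] poly_smult[abs_def])

lemma gegen_mean_sum:
  assumes "lam > - 1 / 2"
  shows "gegen_mean lam (\<Sum>i\<in>I. p i) = (\<Sum>i\<in>I. gegen_mean lam (p i))"
  using integrable_poly_gegen_measure[OF assms] by (simp add: gegen_mean_def poly_sum)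

lemma gegen_mean_1: "lam > - 1 / 2 \<Longrightarrow> gegen_mean lam 1 = 1"
  using gegen_measure_total[of lam] by (simp add: gegen_mean_def)

text \<open>
  Eigenfunctions of a symmetric operator for distinct eigenvalues. The eigenvalues \<open>n (n + 2 \<lambda>)\<close> are
  distinct because \<open>m (m + 2 \<lambda>) - n (n + 2 \<lambda>) = (m - n) (m + n + 2 \<lambda>)\<close> and \<open>\<lambda> > -1/2\<close>.
\<close>

lemma gegen_poly_orthogonal:
  assumes lam: "lam > - 1 / 2" and "m \<noteq> n"
  shows "gegen_mean lam (gegen_poly lam m * gegen_poly lam n) = 0"
proof -
  let ?I = "gegen_mean lam (gegen_poly lam m * gegen_poly lam n)"
  have "gegen_mean lam (gegen_op lam (gegen_poly lam m) * gegen_poly lam n)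
      = gegen_mean lam (gegen_poly lam m * gegen_op lam (gegen_poly lam n))"
    using gegen_op_self_adjoint[OF lam] by (simp add: gegen_mean_def)
  then have "real m * (real m + 2 * lam) * ?I = real n * (real n + 2 * lam) * ?I"
    unfolding gegen_op_gegen_poly by (simp add: gegen_mean_linear[OF lam])
  then have "(real m - real n) * (real m + real n + 2 * lam) * ?I = 0"
    by (simp add: algebra_simps)
  moreover have "real m + real n \<ge> 1" using \<open>m \<noteq> n\<close> by linarith
  ultimately show ?thesis using assms by auto
qed

text \<open>
  The coefficients in \<open>t C\<^sub>n = up\<^sub>n C\<^sub>n\<^sub>+\<^sub>1 + down\<^sub>n C\<^sub>n\<^sub>-\<^sub>1\<close>; the Chebyshev case needs its own value at
  \<open>n = 0\<close>, since \<open>t T\<^sub>0 = T\<^sub>1\<close> has coefficient \<open>1\<close>.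
\<close>

definition gegen_up :: "real \<Rightarrow> nat \<Rightarrow> real" where
  "gegen_up lam n = (if lam = 0 then (if n = 0 then 1 else 1 / 2) else (real n + 1) / (2 * (real n + lam)))"

definition gegen_down :: "real \<Rightarrow> nat \<Rightarrow> real" where
  "gegen_down lam n = (if lam = 0 then 1 / 2 else (real n + 2 * lam - 1) / (2 * (real n + lam)))"

lemma gegen_up_mult_down:
  assumes "lam \<noteq> 0 \<or> n \<noteq> 0"
  shows "gegen_up lam n * gegen_down lam (Suc n)
       = (real n + 1) * (real n + 2 * lam) / ((real n + lam) * (real n + 1 + lam)) / 4"
proof (cases "lam = 0")
  case True
  then show ?thesis using assms by (simp add: gegen_up_def gegen_down_def)
next
  case False
  have "real (Suc n) + 2 * lam - 1 = real n + 2 * lam" "real (Suc n) + lam = real n + 1 + lam"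
    by simp_all
  then have "gegen_up lam n = (real n + 1) / (2 * (real n + lam))"
    "gegen_down lam (Suc n) = (real n + 2 * lam) / (2 * (real n + 1 + lam))"
    using False unfolding gegen_up_def gegen_down_def by presburger+
  moreover have "u / (2 * x) * (v / (2 * y)) = u * v / (x * y) / 4" for u v x y :: real by simp
  ultimately show ?thesis by (simp only:)
qed

lemma gegen_poly_recurrence:
  assumes lam: "lam > - 1 / 2"
  shows "[:0, 1:] * gegen_poly lam 0 = smult (gegen_up lam 0) (gegen_poly lam 1)"
    and "[:0, 1:] * gegen_poly lam (Suc n)
          = smult (gegen_up lam (Suc n)) (gegen_poly lam (Suc (Suc n)))
            + smult (gegen_down lam (Suc n)) (gegen_poly lam n)"
proof -
  show "[:0, 1:] * gegen_poly lam 0 = smult (gegen_up lam 0) (gegen_poly lam 1)"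
    by (simp add: gegen_poly_def gegen_up_def)
  show "[:0, 1:] * gegen_poly lam (Suc n)
          = smult (gegen_up lam (Suc n)) (gegen_poly lam (Suc (Suc n)))
            + smult (gegen_down lam (Suc n)) (gegen_poly lam n)" (is "?l = ?r")
  proof -
    define m where "m = real n + 1 + lam"
    have m: "m > 0" using lam by (simp add: m_def)
    have "poly ?l x = poly ?r x" for x
    proof (cases "lam = 0")
      case True
      then show ?thesis by (simp add: gegen_poly_def gegen_up_def gegen_down_def field_simps)
    next
      case False
      define u v c where "u = poly (gegenbauer_poly lam (Suc n)) x" and "v = poly (gegenbauer_poly lam n) x"
        and "c = poly (gegenbauer_poly lam (Suc (Suc n))) x"
      have "(real n + 2) * c = 2 * m * x * u - (real n + 2 * lam) * v"
        by (simp add: c_def u_def v_def m_def mult_ac)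
      moreover have "real (Suc n) + 1 = real n + 2" "real (Suc n) + 2 * lam - 1 = real n + 2 * lam"
        "real (Suc n) + lam = m" by (simp_all add: m_def)
      then have "gegen_up lam (Suc n) = (real n + 2) / (2 * m)"
        "gegen_down lam (Suc n) = (real n + 2 * lam) / (2 * m)"
        using False unfolding gegen_up_def gegen_down_def by presburger+
      moreover have "poly ?r x = gegen_up lam (Suc n) * c + gegen_down lam (Suc n) * v"
        using False by (simp add: gegen_poly_def c_def v_def)
      ultimately have "poly ?r x = (2 * m * x * u) / (2 * m)"
        by (simp flip: add_divide_distrib)
      then show ?thesis using False m by (simp add: gegen_poly_def u_def)
    qed
    then show ?thesis by (intro iffD1[OF poly_eq_poly_eq_iff] ext)
  qed
qed

definition gegen_sqnorm :: "real \<Rightarrow> nat \<Rightarrow> real" where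
  "gegen_sqnorm lam n = gegen_mean lam (gegen_poly lam n * gegen_poly lam n)"

lemma gegen_mean_t_mult:
  assumes lam: "lam > - 1 / 2" and "m \<le> n"
  shows "gegen_mean lam ([:0, 1:] * gegen_poly lam m * gegen_poly lam n)
       = (if n = Suc m then gegen_up lam m * gegen_sqnorm lam n else 0)"
proof (cases m)
  case 0
  then show ?thesis
    using gegen_poly_orthogonal[OF lam, of 1 n]
    by (auto simp: gegen_poly_recurrence(1)[OF lam] gegen_mean_linear[OF lam] gegen_sqnorm_def
        simp del: mult_pCons_left mult_pCons_right)
next
  case (Suc k)
  have "gegen_mean lam ([:0, 1:] * gegen_poly lam m * gegen_poly lam n)
      = gegen_up lam m * gegen_mean lam (gegen_poly lam (Suc m) * gegen_poly lam n)
       + gegen_down lam m * gegen_mean lam (gegen_poly lam k * gegen_poly lam n)"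
    unfolding Suc gegen_poly_recurrence(2)[OF lam]
    by (simp add: gegen_mean_linear[OF lam] distrib_right)
  moreover have "gegen_mean lam (gegen_poly lam k * gegen_poly lam n) = 0"
    using assms Suc by (intro gegen_poly_orthogonal) auto
  moreover have "gegen_mean lam (gegen_poly lam (Suc m) * gegen_poly lam n) = 0" if "n \<noteq> Suc m"
    using that by (intro gegen_poly_orthogonal[OF lam]) auto
  ultimately show ?thesis by (auto simp: gegen_sqnorm_def)
qed

text \<open>
  The integral of \<open>t C\<^sub>n C\<^sub>n\<^sub>+\<^sub>1\<close> is computed twice, expanding \<open>t C\<^sub>n\<close> or \<open>t C\<^sub>n\<^sub>+\<^sub>1\<close> by the recurrence.
\<close>

lemma gegen_sqnorm_recurrence:
  assumes lam: "lam > - 1 / 2"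
  shows "gegen_up lam n * gegen_sqnorm lam (Suc n) = gegen_down lam (Suc n) * gegen_sqnorm lam n"
proof -
  have "gegen_mean lam ([:0, 1:] * gegen_poly lam (Suc n) * gegen_poly lam n)
      = gegen_up lam (Suc n) * gegen_mean lam (gegen_poly lam (Suc (Suc n)) * gegen_poly lam n)
       + gegen_down lam (Suc n) * gegen_mean lam (gegen_poly lam n * gegen_poly lam n)"
    unfolding gegen_poly_recurrence(2)[OF lam]
    by (simp add: gegen_mean_linear[OF lam] distrib_right)
  moreover have "gegen_mean lam (gegen_poly lam (Suc (Suc n)) * gegen_poly lam n) = 0"
    by (rule gegen_poly_orthogonal[OF lam]) simp
  moreover have "[:0, 1:] * gegen_poly lam (Suc n) * gegen_poly lam n
      = [:0, 1:] * gegen_poly lam n * gegen_poly lam (Suc n)"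
    by (simp only: mult_ac)
  ultimately show ?thesis
    using gegen_mean_t_mult[OF lam, of n "Suc n"] by (simp add: gegen_sqnorm_def del: mult_pCons_left mult_pCons_right)
qed

text \<open>
  By the recurrence, each squared norm is a positive multiple of the preceding one. For negative \<open>\<lambda>\<close>
  both coefficients at the step from \<open>0\<close> to \<open>1\<close> are negative, hence the argument with their product.
\<close>

lemma gegen_sqnorm_pos:
  assumes lam: "lam > - 1 / 2"
  shows "gegen_sqnorm lam n > 0"
proof (induction n)
  case 0
  then show ?case
    using gegen_mean_1[OF lam] by (cases "lam = 0") (auto simp: gegen_sqnorm_def gegen_poly_def)
next
  case (Suc n)
  have "gegen_up lam n * gegen_down lam (Suc n) > 0"
  proof (cases "lam = 0")
    case True
    then show ?thesis by (simp add: gegen_up_def gegen_down_def)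
  next
    case False
    define r where "r = (real n + 2 * lam) / (real n + lam)"
    have "r > 0"
    proof (cases "n = 0")
      case True
      then show ?thesis using \<open>lam \<noteq> 0\<close> by (simp add: r_def)
    next
      case False
      then have "real n \<ge> 1" by simp
      then show ?thesis using lam unfolding r_def by (intro divide_pos_pos) linarith+
    qed
    moreover have "real n + 1 + lam > 0" using lam by linarith
    ultimately have "(real n + 1) * r / (real n + 1 + lam) / 4 > 0"
      by (intro divide_pos_pos mult_pos_pos) auto
    moreover have "gegen_up lam n * gegen_down lam (Suc n) = (real n + 1) * r / (real n + 1 + lam) / 4"
      using gegen_up_mult_down[of lam n] False by (simp add: r_def)
    ultimately show ?thesis by simp
  qed
  moreover have "gegen_up lam n * gegen_up lam n * gegen_sqnorm lam (Suc n)
      = gegen_up lam n * gegen_down lam (Suc n) * gegen_sqnorm lam n"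
    using gegen_sqnorm_recurrence[OF lam, of n] by simp
  ultimately have "gegen_up lam n * gegen_up lam n * gegen_sqnorm lam (Suc n) > 0"
    using Suc.IH by (metis mult_pos_pos)
  then show ?case
    by (metis not_square_less_zero zero_less_mult_iff)
qed

lemma orthonormal_gegen_poly_eq:
  assumes lam: "lam > - 1 / 2"
  shows "orthonormal_gegen_poly lam n = smult (1 / sqrt (gegen_sqnorm lam n)) (gegen_poly lam n)"
proof -
  let ?q = "poly (gegen_poly lam n * gegen_poly lam n)"
  have "?q \<in> borel_measurable (lebesgue_on {-1..1})"
    by (rule continuous_imp_measurable_on_sets_lebesgue) (auto intro!: continuous_intros)
  from gegen_measure_integral(2)[OF lam this]
  have "gegen_sqnorm lam n
      = gegen_const lam * (LINT t|lebesgue_on {-1..1}. \<bar>poly (gegen_poly lam n) t\<bar>\<^sup>2 * gegen_weight lam t)"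
    by (simp add: gegen_sqnorm_def gegen_mean_def power2_eq_square poly_mult[abs_def])
  then show ?thesis by (simp add: orthonormal_gegen_poly_def)
qed

lemma orthonormal_gegen_poly_orthonormal:
  assumes lam: "lam > - 1 / 2"
  shows "gegen_mean lam (orthonormal_gegen_poly lam m * orthonormal_gegen_poly lam n)
       = (if m = n then 1 else 0)"
  using gegen_poly_orthogonal[OF lam, of m n] gegen_sqnorm_pos[OF lam, of n]
  by (auto simp: orthonormal_gegen_poly_eq[OF lam] gegen_mean_linear[OF lam]
      simp flip: gegen_sqnorm_def)

text \<open>
  The off-diagonal entry \<open>\<alpha>\<^sub>n\<close> of the Jacobi matrix, valid for \<open>n \<ge> 1\<close>; it is the geometric mean of
  \<^const>\<open>gegen_up\<close> at \<open>n\<close> and \<^const>\<open>gegen_down\<close> at \<open>n + 1\<close>.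
\<close>

definition jacobi_entry :: "real \<Rightarrow> nat \<Rightarrow> real" where
  "jacobi_entry lam n
     = sqrt ((real n + 1) * (real n + 2 * lam) / ((real n + lam) * (real n + 1 + lam))) / 2"

lemma orthonormal_gegen_poly_t_mult_le:
  assumes lam: "lam > - 1 / 2" and mn: "1 \<le> m" "m \<le> n"
  shows "gegen_mean lam ([:0, 1:] * orthonormal_gegen_poly lam m * orthonormal_gegen_poly lam n)
       = (if n = Suc m then jacobi_entry lam m else 0)"
proof -
  define a b where "a = gegen_up lam m" and "b = gegen_down lam (Suc m)"
  have m1: "real m \<ge> 1" using mn by simp
  have ab: "a > 0" using lam mn m1 by (auto simp: gegen_up_def a_def)
  have "a * b = (real m + 1) * (real m + 2 * lam) / ((real m + lam) * (real m + 1 + lam)) / 4"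
    using gegen_up_mult_down[of lam m] mn by (simp add: a_def b_def)
  then have j: "jacobi_entry lam m = sqrt (a * b)"
    by (simp only: jacobi_entry_def real_sqrt_divide real_sqrt_four)
  have pos: "gegen_sqnorm lam m > 0" "gegen_sqnorm lam (Suc m) > 0"
    using gegen_sqnorm_pos[OF lam] by auto
  have "gegen_sqnorm lam (Suc m) = b / a * gegen_sqnorm lam m"
    using gegen_sqnorm_recurrence[OF lam, of m] ab by (simp add: a_def b_def field_simps)
  then have s: "sqrt (gegen_sqnorm lam (Suc m)) = sqrt (b / a) * sqrt (gegen_sqnorm lam m)"
    by (simp only: real_sqrt_mult)
  have "a * gegen_sqnorm lam (Suc m) / (sqrt (gegen_sqnorm lam m) * sqrt (gegen_sqnorm lam (Suc m)))
      = a * sqrt (gegen_sqnorm lam (Suc m)) / sqrt (gegen_sqnorm lam m)"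
    using pos by (simp add: field_simps)
  also have "\<dots> = a * sqrt (b / a)" using pos by (simp add: s)
  also have "\<dots> = sqrt (a * b)"
    using ab by (simp add: real_sqrt_divide real_sqrt_mult field_simps)
  finally have key: "a * gegen_sqnorm lam (Suc m) / (sqrt (gegen_sqnorm lam m) * sqrt (gegen_sqnorm lam (Suc m)))
      = jacobi_entry lam m" by (simp add: j)
  have "gegen_mean lam ([:0, 1:] * orthonormal_gegen_poly lam m * orthonormal_gegen_poly lam n)
      = gegen_mean lam ([:0, 1:] * gegen_poly lam m * gegen_poly lam n)
        / (sqrt (gegen_sqnorm lam m) * sqrt (gegen_sqnorm lam n))"
    by (simp add: orthonormal_gegen_poly_eq[OF lam] gegen_mean_linear[OF lam] mult_ac
        del: mult_pCons_left mult_pCons_right)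
  then show ?thesis
    using key gegen_mean_t_mult[OF lam mn(2)] by (simp add: a_def)
qed

text \<open>
  The index \<open>0\<close> is left out because all functions to be expanded have mean zero.
\<close>

definition gegen_sum :: "real \<Rightarrow> (nat \<Rightarrow> real) \<Rightarrow> nat \<Rightarrow> real poly" where
  "gegen_sum lam b N = (\<Sum>n=1..N. smult (b n) (orthonormal_gegen_poly lam n))"

lemma gegen_sum_simps:
  "gegen_sum lam b 0 = 0"
  "gegen_sum lam b (Suc N) = gegen_sum lam b N + smult (b (Suc N)) (orthonormal_gegen_poly lam (Suc N))"
  by (simp_all add: gegen_sum_def)

lemma gegen_sum_coeff:
  assumes lam: "lam > - 1 / 2"
  shows "gegen_mean lam (gegen_sum lam b N * orthonormal_gegen_poly lam k)
       = (if k \<in> {1..N} then b k else 0)"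
  by (simp add: gegen_sum_def sum_distrib_right gegen_mean_sum[OF lam] gegen_mean_linear[OF lam]
      orthonormal_gegen_poly_orthonormal[OF lam] if_distrib[of "\<lambda>x. _ * x"] cong: if_cong)

lemma orthonormal_expansion_sqnorm:
  fixes b :: "nat \<Rightarrow> real"
  assumes lam: "lam > - 1 / 2" and "finite I"
  defines "q \<equiv> \<Sum>n\<in>I. smult (b n) (orthonormal_gegen_poly lam n)"
  shows "gegen_mean lam (q * q) = (\<Sum>n\<in>I. (b n)\<^sup>2)"
proof -
  have "gegen_mean lam (q * q) = (\<Sum>m\<in>I. \<Sum>n\<in>I. b m * (b n * (if m = n then 1 else 0)))"
    unfolding q_def sum_product
    by (simp add: gegen_mean_sum[OF lam] gegen_mean_linear[OF lam] orthonormal_gegen_poly_orthonormal[OF lam]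
        mult_ac)
  also have "\<dots> = (\<Sum>m\<in>I. \<Sum>n\<in>I. if m = n then b m * b n else 0)"
    by (intro sum.cong refl) auto
  also have "\<dots> = (\<Sum>n\<in>I. (b n)\<^sup>2)"
    using \<open>finite I\<close> by (simp add: power2_eq_square)
  finally show ?thesis .
qed

lemma gegen_sum_t_mult:
  assumes lam: "lam > - 1 / 2"
  shows "gegen_mean lam ([:0, 1:] * gegen_sum lam b N * gegen_sum lam b N)
       = 2 * (\<Sum>n=1..<N. jacobi_entry lam n * b n * b (Suc n))"
proof (induction N)
  case 0
  then show ?case by (simp add: gegen_sum_simps gegen_mean_def)
next
  case (Suc N)
  let ?P = "gegen_sum lam b N" and ?p = "orthonormal_gegen_poly lam (Suc N)" and ?X = "[:0, 1:] :: real poly"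
  have "?X * gegen_sum lam b (Suc N) * gegen_sum lam b (Suc N)
      = ?X * ?P * ?P + smult (b (Suc N)) (?X * ?P * ?p) + smult (b (Suc N)) (?X * ?P * ?p) + smult ((b (Suc N))\<^sup>2) (?X * ?p * ?p)"
    by (simp add: gegen_sum_simps distrib_left distrib_right power2_eq_square mult.commute mult.left_commute
        smult_add_right del: mult_pCons_left mult_pCons_right)
  then have "gegen_mean lam (?X * gegen_sum lam b (Suc N) * gegen_sum lam b (Suc N))
      = gegen_mean lam (?X * ?P * ?P) + b (Suc N) * gegen_mean lam (?X * ?P * ?p)
        + b (Suc N) * gegen_mean lam (?X * ?P * ?p) + (b (Suc N))\<^sup>2 * gegen_mean lam (?X * ?p * ?p)"
    by (simp only: gegen_mean_linear[OF lam])
  moreover have "gegen_mean lam (?X * ?p * ?p) = 0"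
    using orthonormal_gegen_poly_t_mult_le[OF lam, of "Suc N" "Suc N"] by simp
  moreover have "gegen_mean lam (?X * ?P * ?p) = (\<Sum>n=1..N. b n * (if N = n then jacobi_entry lam n else 0))"
  proof -
    have "gegen_mean lam (?X * ?P * ?p)
        = (\<Sum>n=1..N. b n * gegen_mean lam (?X * orthonormal_gegen_poly lam n * ?p))"
      by (simp add: gegen_sum_def sum_distrib_right sum_distrib_left gegen_mean_sum[OF lam]
          gegen_mean_linear[OF lam] del: mult_pCons_left mult_pCons_right)
    also have "\<dots> = (\<Sum>n=1..N. b n * (if N = n then jacobi_entry lam n else 0))"
      by (intro sum.cong refl) (simp add: orthonormal_gegen_poly_t_mult_le[OF lam] del: mult_pCons_left mult_pCons_right)
    finally show ?thesis .
  qed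
  moreover have "(\<Sum>n=1..N. b n * (if N = n then jacobi_entry lam n else 0))
      = (if N = 0 then 0 else b N * jacobi_entry lam N)"
    by (simp add: if_distrib[of "\<lambda>x. _ * x"] cong: if_cong)
  ultimately show ?case
    using Suc by (cases "N = 0") (simp_all add: algebra_simps del: mult_pCons_left mult_pCons_right)
qed

section \<open>Expansions and reduction to a discrete Hardy inequality\<close>

text \<open>
  The span contains \<open>1\<close>, and the recurrence shows that it is closed under multiplication by \<open>t\<close>; so it
  contains every polynomial. Quantifying over all large \<open>M\<close> makes the closure under addition
  immediate, as no zero padding is needed.
\<close>

lemma polynomial_in_gegen_span:
  assumes lam: "lam > - 1 / 2"
  shows "\<exists>N a. \<forall>M\<ge>N. q = (\<Sum>k\<le>M. smult (a k) (orthonormal_gegen_poly lam k))"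
proof -
  let ?P = "orthonormal_gegen_poly lam"
  define E where "E q \<longleftrightarrow> (\<exists>N a. \<forall>M\<ge>(N::nat). q = (\<Sum>k\<le>M. smult (a k) (?P k)))" for q
  have E_add: "E (p + q)" if "E p" "E q" for p q
  proof -
    obtain N a where 1: "\<And>M. M \<ge> N \<Longrightarrow> p = (\<Sum>k\<le>M. smult (a k) (?P k))"
      using \<open>E p\<close> unfolding E_def by blast
    obtain N' a' where 2: "\<And>M. M \<ge> N' \<Longrightarrow> q = (\<Sum>k\<le>M. smult (a' k) (?P k))"
      using \<open>E q\<close> unfolding E_def by blast
    have "\<forall>M\<ge>max N N'. p + q = (\<Sum>k\<le>M. smult (a k + a' k) (?P k))"
    proof (intro allI impI)
      fix M assume "M \<ge> max N N'"
      then show "p + q = (\<Sum>k\<le>M. smult (a k + a' k) (?P k))"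
        using 1[of M] 2[of M] by (simp add: smult_add_left sum.distrib)
    qed
    then show ?thesis unfolding E_def by (intro exI[of _ "max N N'"] exI[of _ "\<lambda>k. a k + a' k"])
  qed
  have smult_sum: "smult c (\<Sum>k\<le>M. p k) = (\<Sum>k\<le>M. smult c (p k))" for c M and p :: "nat \<Rightarrow> real poly"
    by (induction M) (simp_all add: smult_add_right)
  have E_smult: "E (smult c p)" if "E p" for c p
  proof -
    obtain N a where 1: "\<And>M. M \<ge> N \<Longrightarrow> p = (\<Sum>k\<le>M. smult (a k) (?P k))"
      using \<open>E p\<close> unfolding E_def by blast
    have "\<forall>M\<ge>N. smult c p = (\<Sum>k\<le>M. smult (c * a k) (?P k))"
    proof (intro allI impI)
      fix M assume "M \<ge> N"
      then have "smult c p = smult c (\<Sum>k\<le>M. smult (a k) (?P k))" using 1 by metis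
      then show "smult c p = (\<Sum>k\<le>M. smult (c * a k) (?P k))" by (simp add: smult_sum)
    qed
    then show ?thesis unfolding E_def by (intro exI)
  qed
  have E_sum: "E (\<Sum>i\<in>I. p i)" if "\<And>i. E (p i)" "finite I" for I :: "nat set" and p
    using that(2)
  proof (induction I rule: finite_induct)
    case empty
    have "\<forall>M\<ge>0. (0 :: real poly) = (\<Sum>k\<le>M. smult 0 (?P k))" by simp
    then show ?case unfolding E_def sum.empty by (intro exI)
  qed (simp add: E_add that(1))
  have E_P: "E (?P m)" for m
  proof -
    have "?P m = (\<Sum>k\<le>M. smult (if k = m then 1 else 0) (?P k))" if "M \<ge> m" for M
      using that by (simp add: if_distrib[of "\<lambda>c. smult c _"] cong: if_cong)
    then show ?thesis unfolding E_def by (intro exI[of _ m] exI[of _ "\<lambda>k. if k = m then 1 else 0"]) auto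
  qed
  have P_eq: "?P m = smult (1 / sqrt (gegen_sqnorm lam m)) (gegen_poly lam m)" for m
    by (rule orthonormal_gegen_poly_eq[OF lam])
  have E_q: "E (gegen_poly lam m)" for m
  proof -
    have "gegen_poly lam m = smult (sqrt (gegen_sqnorm lam m)) (?P m)"
      using gegen_sqnorm_pos[OF lam, of m] by (simp add: P_eq)
    then show ?thesis using E_smult[OF E_P] by simp
  qed
  have E_xq: "E ([:0, 1:] * gegen_poly lam m)" for m
    by (cases m) (simp_all only: gegen_poly_recurrence[OF lam] E_add E_smult E_q)
  have E_x: "E ([:0, 1:] * p)" if "E p" for p
  proof -
    obtain N a where "\<And>M. M \<ge> N \<Longrightarrow> p = (\<Sum>k\<le>M. smult (a k) (?P k))"
      using \<open>E p\<close> unfolding E_def by blast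
    from this[OF order_refl] have "[:0, 1:] * p
        = (\<Sum>k\<le>N. smult (a k * (1 / sqrt (gegen_sqnorm lam k))) ([:0, 1:] * gegen_poly lam k))"
      by (simp only: sum_distrib_left mult_smult_right P_eq smult_smult)
    then show ?thesis using E_sum[OF E_smult[OF E_xq]] by simp
  qed
  have "E q"
  proof (induction q)
    case 0
    show ?case using E_smult[OF E_P, of 0] by simp
  next
    case (pCons c p)
    have "gegen_poly lam 0 = 1" by (simp add: gegen_poly_def)
    then have "pCons c p = smult c (gegen_poly lam 0) + [:0, 1:] * p"
      by simp
    then show ?case using E_add[OF E_smult[OF E_q] E_x[OF pCons.IH]] by metis
  qed
  then show ?thesis unfolding E_def .
qed

definition gegen_rcoeff :: "real \<Rightarrow> (real \<Rightarrow> real) \<Rightarrow> nat \<Rightarrow> real" where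
  "gegen_rcoeff lam f n = (LINT t|gegen_measure lam. f t * poly (orthonormal_gegen_poly lam n) t)"

lemma sqdist_expansion:
  fixes b :: "nat \<Rightarrow> real"
  assumes lam: "lam > - 1 / 2" and f: "square_integrable (gegen_measure lam) f" and I: "finite I"
  defines "q \<equiv> \<Sum>n\<in>I. smult (b n) (orthonormal_gegen_poly lam n)"
  shows "(LINT t|gegen_measure lam. (f t - poly q t)\<^sup>2)
       = (LINT t|gegen_measure lam. (f t)\<^sup>2) - 2 * (\<Sum>n\<in>I. b n * gegen_rcoeff lam f n) + (\<Sum>n\<in>I. (b n)\<^sup>2)"
proof -
  let ?M = "gegen_measure lam"
  have ff: "integrable ?M (\<lambda>t. (f t)\<^sup>2)" using f by (simp add: square_integrable_def)
  have fp: "integrable ?M (\<lambda>t. f t * poly p t)" for p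
    by (rule square_integrable_mult[OF f square_integrable_poly[OF lam]])
  have pp: "integrable ?M (\<lambda>t. poly q t * poly q t)"
    by (rule square_integrable_mult[OF square_integrable_poly[OF lam] square_integrable_poly[OF lam]])
  have "(LINT t|?M. f t * poly q t) = (\<Sum>n\<in>I. b n * gegen_rcoeff lam f n)"
  proof -
    have "f t * poly q t = (\<Sum>n\<in>I. b n * (f t * poly (orthonormal_gegen_poly lam n) t))" for t
      by (simp add: q_def poly_sum sum_distrib_left mult_ac)
    then show ?thesis using fp by (simp add: gegen_rcoeff_def)
  qed
  moreover have "(LINT t|?M. poly q t * poly q t) = (\<Sum>n\<in>I. (b n)\<^sup>2)"
    using orthonormal_expansion_sqnorm[OF lam I, of b]
    by (simp add: gegen_mean_def q_def poly_mult[abs_def])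
  moreover have "(f t - poly q t)\<^sup>2 = (f t)\<^sup>2 - 2 * (f t * poly q t) + poly q t * poly q t" for t
    by (simp add: power2_eq_square algebra_simps)
  ultimately show ?thesis using ff fp[of q] pp by simp
qed

text \<open>
  Completeness: the partial sum is the best approximation within its span, and the polynomials are
  dense.
\<close>

lemma gegen_expansion_converges:
  assumes lam: "lam > - 1 / 2" and f: "square_integrable (gegen_measure lam) f"
  shows "(\<lambda>N. LINT t|gegen_measure lam. (f t - poly (\<Sum>n\<le>N. smult (gegen_rcoeff lam f n)
            (orthonormal_gegen_poly lam n)) t)\<^sup>2) \<longlonglongrightarrow> 0"
proof (rule order_tendstoI)
  fix e :: real assume "e < 0"
  then show "eventually (\<lambda>N. e < (LINT t|gegen_measure lam. (f t - poly (\<Sum>n\<le>N. smult (gegen_rcoeff lam f n)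
            (orthonormal_gegen_poly lam n)) t)\<^sup>2)) sequentially"
    by (intro always_eventually allI less_le_trans[OF _ Bochner_Integration.integral_nonneg]) auto
next
  fix e :: real assume e: "e > 0"
  let ?w = "\<lambda>t. gegen_const lam * gegen_weight lam t"
  have w: "integrable (lebesgue_on {-1..1}) ?w" "\<And>t. 0 \<le> ?w t"
    using gegen_weight_integrable[OF lam] gegen_const_pos[OF lam] by (auto simp: gegen_weight_nonneg)
  obtain q where q: "(LINT t|gegen_measure lam. (f t - poly q t)\<^sup>2) < e"
    using polynomials_dense_L2[OF w f[unfolded gegen_measure_def] e] unfolding gegen_measure_def by blast
  obtain N a where Na: "\<And>M. M \<ge> N \<Longrightarrow> q = (\<Sum>k\<le>M. smult (a k) (orthonormal_gegen_poly lam k))"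
    using polynomial_in_gegen_span[OF lam] by blast
  have "(LINT t|gegen_measure lam. (f t - poly (\<Sum>n\<le>M. smult (gegen_rcoeff lam f n)
            (orthonormal_gegen_poly lam n)) t)\<^sup>2) < e" if "M \<ge> N" for M
  proof -
    let ?c = "gegen_rcoeff lam f" and ?n2 = "LINT t|gegen_measure lam. (f t)\<^sup>2"
    have "(LINT t|gegen_measure lam. (f t - poly (\<Sum>n\<le>M. smult (?c n) (orthonormal_gegen_poly lam n)) t)\<^sup>2)
        = ?n2 - (\<Sum>n\<le>M. (?c n)\<^sup>2)"
      by (subst sqdist_expansion[OF lam f]) (auto simp: power2_eq_square)
    also have "\<dots> \<le> ?n2 - (\<Sum>n\<le>M. (?c n)\<^sup>2) + (\<Sum>n\<le>M. (a n - ?c n)\<^sup>2)"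
      by (simp add: sum_nonneg)
    also have "\<dots> = ?n2 - 2 * (\<Sum>n\<le>M. a n * ?c n) + (\<Sum>n\<le>M. (a n)\<^sup>2)"
      by (simp add: power2_diff sum.distrib sum_subtractf sum_distrib_left mult.assoc)
    also have "\<dots> = (LINT t|gegen_measure lam. (f t - poly q t)\<^sup>2)"
      by (subst Na[OF that], subst sqdist_expansion[OF lam f]) auto
    finally show ?thesis using q by simp
  qed
  then show "eventually (\<lambda>N. (LINT t|gegen_measure lam. (f t - poly (\<Sum>n\<le>N. smult (gegen_rcoeff lam f n)
            (orthonormal_gegen_poly lam n)) t)\<^sup>2) < e) sequentially"
    unfolding eventually_sequentially by blast
qed

text \<open>
  The quadratic form of the identity minus the Jacobi matrix, restricted to indices \<open>1\<close> to \<open>N\<close>; it is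
  the weighted integral of \<open>(1 - t)\<close> times the square of the corresponding polynomial.
\<close>

definition jacobi_form :: "real \<Rightarrow> (nat \<Rightarrow> real) \<Rightarrow> nat \<Rightarrow> real" where
  "jacobi_form lam b N = (\<Sum>n=1..N. (b n)\<^sup>2) - 2 * (\<Sum>n=1..<N. jacobi_entry lam n * b n * b (Suc n))"

definition jacobi_hardy :: "real \<Rightarrow> real \<Rightarrow> bool" where
  "jacobi_hardy lam C \<longleftrightarrow>
     (\<forall>b N. (\<Sum>n=1..N. (b n)\<^sup>2 / (real n * (real n + 2 * lam))) \<le> C * jacobi_form lam b N)"

lemma gegen_sum_jacobi_form:
  assumes lam: "lam > - 1 / 2"
  shows "(LINT t|gegen_measure lam. (1 - t) * (poly (gegen_sum lam b N) t)\<^sup>2) = jacobi_form lam b N"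
proof -
  let ?S = "gegen_sum lam b N"
  have "jacobi_form lam b N = gegen_mean lam (?S * ?S - [:0, 1:] * ?S * ?S)"
    using gegen_sum_t_mult[OF lam, of b N] orthonormal_expansion_sqnorm[OF lam, of "{1..N}" b]
    by (simp add: gegen_mean_linear[OF lam] jacobi_form_def gegen_sum_def del: mult_pCons_left)
  also have "\<dots> = (LINT t|gegen_measure lam. (1 - t) * (poly ?S t)\<^sup>2)"
    unfolding gegen_mean_def by (intro Bochner_Integration.integral_cong refl) (simp add: power2_eq_square algebra_simps)
  finally show ?thesis by simp
qed

lemma gegen_sum_eq_atMost:
  assumes "b 0 = 0"
  shows "gegen_sum lam b N = (\<Sum>n\<le>N. smult (b n) (orthonormal_gegen_poly lam n))"
proof -
  have "{..N} = insert 0 {1..N}" by auto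
  then show ?thesis using assms by (simp add: gegen_sum_def)
qed

text \<open>
  The discrete inequality is applied to the partial sums. The partial sums of \<open>g\<close> are compared with
  \<open>g\<close> by \<open>(y - z)\<^sup>2 \<le> (1 + e) y\<^sup>2 + (1 + 1/e) z\<^sup>2\<close>, which allows the limit in \<open>N\<close> first and then \<open>e \<rightarrow> 0\<close>.
\<close>

lemma jacobi_hardy_imp_real_inequality:
  assumes lam: "lam > - 1 / 2" and H: "jacobi_hardy lam C" and C: "C \<ge> 0"
    and f: "square_integrable (gegen_measure lam) f" and g: "square_integrable (gegen_measure lam) g"
    and f0: "gegen_rcoeff lam f 0 = 0" and g0: "gegen_rcoeff lam g 0 = 0"
    and fg: "\<And>n. n \<ge> 1 \<Longrightarrow>
      gegen_rcoeff lam g n = sqrt (real n * (real n + 2 * lam)) * gegen_rcoeff lam f n"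
  shows "(LINT t|gegen_measure lam. (f t)\<^sup>2) \<le> C * (LINT t|gegen_measure lam. (1 - t) * (g t)\<^sup>2)"
proof -
  let ?M = "gegen_measure lam"
  define a b where "a = gegen_rcoeff lam f" and "b = gegen_rcoeff lam g"
  define A B where "A N = (LINT t|?M. (f t - poly (gegen_sum lam a N) t)\<^sup>2)"
    and "B N = (LINT t|?M. (g t - poly (gegen_sum lam b N) t)\<^sup>2)" for N
  let ?I = "LINT t|?M. (1 - t) * (g t)\<^sup>2"
  have A: "A \<longlonglongrightarrow> 0"
    using gegen_expansion_converges[OF lam f] gegen_sum_eq_atMost[of a lam] f0
    by (simp add: A_def[abs_def] a_def)
  have B: "B \<longlonglongrightarrow> 0"
    using gegen_expansion_converges[OF lam g] gegen_sum_eq_atMost[of b lam] g0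
    by (simp add: B_def[abs_def] b_def)
  have I0: "?I \<ge> 0"
    by (rule integral_nonneg_AE) (auto intro!: AE_I2 simp: space_gegen_measure)
  have hm: "(\<lambda>t. 1 - t) \<in> borel_measurable ?M"
    using gegen_measure_continuous(2)[OF lam, of "\<lambda>t. 1 - t"]
    by (simp add: square_integrable_def continuous_intros)
  have int: "integrable ?M (\<lambda>t. (1 - t) * (h t)\<^sup>2)" if "square_integrable ?M h" for h
    by (rule square_integrable_bounded_mult[OF that hm, of 2]) (auto simp: space_gegen_measure)
  have step: "(LINT t|?M. (f t)\<^sup>2) - A N \<le> C * ((1 + e) * ?I + (1 + 1 / e) * (2 * B N))"
    if e: "e > 0" for e N
  proof -
    have "(LINT t|?M. (f t)\<^sup>2) - A N = (\<Sum>n=1..N. (a n)\<^sup>2)"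
      unfolding A_def gegen_sum_def
      by (subst sqdist_expansion[OF lam f]) (auto simp: a_def power2_eq_square)
    also have "\<dots> = (\<Sum>n=1..N. (b n)\<^sup>2 / (real n * (real n + 2 * lam)))"
    proof (intro sum.cong refl)
      fix n assume "n \<in> {1..N}"
      then have n: "n \<ge> 1" by simp
      then have "real n + 2 * lam > 0" using lam by linarith
      then have pos: "real n * (real n + 2 * lam) > 0" using n by simp
      have "(b n)\<^sup>2 = real n * (real n + 2 * lam) * (a n)\<^sup>2"
        using real_sqrt_pow2[OF less_imp_le[OF pos]]
        by (simp only: a_def b_def fg[OF n] power_mult_distrib)
      then show "(a n)\<^sup>2 = (b n)\<^sup>2 / (real n * (real n + 2 * lam))"
        using pos by (metis less_numeral_extra(3) nonzero_mult_div_cancel_left)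
    qed
    also have "\<dots> \<le> C * jacobi_form lam b N"
      using H unfolding jacobi_hardy_def by blast
    also have "\<dots> = C * (LINT t|?M. (1 - t) * (poly (gegen_sum lam b N) t)\<^sup>2)"
      by (simp add: gegen_sum_jacobi_form[OF lam])
    also have "\<dots> \<le> C * ((1 + e) * ?I + (1 + 1 / e) * (2 * B N))"
    proof (rule mult_left_mono[OF _ C])
      let ?r = "\<lambda>t. g t - poly (gegen_sum lam b N) t"
      have r: "square_integrable ?M ?r"
        by (rule square_integrable_diff[OF g square_integrable_poly[OF lam]])
      have "(LINT t|?M. (1 - t) * (poly (gegen_sum lam b N) t)\<^sup>2)
          \<le> (LINT t|?M. (1 + e) * ((1 - t) * (g t)\<^sup>2) + (1 + 1 / e) * (2 * (?r t)\<^sup>2))"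
      proof (rule integral_mono[OF int[OF square_integrable_poly[OF lam]]])
        show "integrable ?M (\<lambda>t. (1 + e) * ((1 - t) * (g t)\<^sup>2) + (1 + 1 / e) * (2 * (?r t)\<^sup>2))"
          using int[OF g] r by (auto simp: square_integrable_def)
        fix t assume "t \<in> space ?M"
        then have t: "0 \<le> 1 - t" "1 - t \<le> 2" by (auto simp: space_gegen_measure)
        have young: "(y - z)\<^sup>2 \<le> (1 + e) * y\<^sup>2 + (1 + 1 / e) * z\<^sup>2" for y z :: real
        proof -
          have "0 \<le> (e * y + z)\<^sup>2 / e" using e by simp
          also have "\<dots> = (1 + e) * y\<^sup>2 + (1 + 1 / e) * z\<^sup>2 - (y - z)\<^sup>2"
            using e by (simp add: field_simps power2_eq_square)
          finally show ?thesis by simp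
        qed
        have "(1 - t) * (poly (gegen_sum lam b N) t)\<^sup>2
            \<le> (1 - t) * ((1 + e) * (g t)\<^sup>2 + (1 + 1 / e) * (?r t)\<^sup>2)"
          using young[of "g t" "?r t"] t by (intro mult_left_mono) auto
        also have "\<dots> = (1 + e) * ((1 - t) * (g t)\<^sup>2) + (1 + 1 / e) * ((1 - t) * (?r t)\<^sup>2)"
          by (simp add: distrib_left mult.left_commute)
        also have "\<dots> \<le> (1 + e) * ((1 - t) * (g t)\<^sup>2) + (1 + 1 / e) * (2 * (?r t)\<^sup>2)"
          using t e by (intro add_left_mono mult_left_mono mult_right_mono) auto
        finally show "(1 - t) * (poly (gegen_sum lam b N) t)\<^sup>2
            \<le> (1 + e) * ((1 - t) * (g t)\<^sup>2) + (1 + 1 / e) * (2 * (?r t)\<^sup>2)" .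
      qed
      also have "\<dots> = (1 + e) * ?I + (1 + 1 / e) * (2 * B N)"
        using int[OF g] r by (simp add: square_integrable_def B_def)
      finally show "(LINT t|?M. (1 - t) * (poly (gegen_sum lam b N) t)\<^sup>2)
          \<le> (1 + e) * ?I + (1 + 1 / e) * (2 * B N)" .
    qed
    finally show ?thesis .
  qed
  have lim: "(LINT t|?M. (f t)\<^sup>2) \<le> C * ((1 + e) * ?I)" if e: "e > 0" for e
  proof (rule LIMSEQ_le)
    show "(\<lambda>N. (LINT t|?M. (f t)\<^sup>2) - A N) \<longlonglongrightarrow> (LINT t|?M. (f t)\<^sup>2)"
      using tendsto_diff[OF tendsto_const A] by simp
    show "(\<lambda>N. C * ((1 + e) * ?I + (1 + 1 / e) * (2 * B N))) \<longlonglongrightarrow> C * ((1 + e) * ?I)"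
      by (rule tendsto_eq_intros B refl | simp)+
    show "\<exists>N. \<forall>n\<ge>N. (LINT t|?M. (f t)\<^sup>2) - A n \<le> C * ((1 + e) * ?I + (1 + 1 / e) * (2 * B n))"
      using step[OF e] by blast
  qed
  show ?thesis
  proof (rule field_le_epsilon)
    fix d :: real assume d: "d > 0"
    define e where "e = d / (C * ?I + 1)"
    have pos: "C * ?I + 1 > 0" using C I0 by (simp add: add_nonneg_pos)
    have "e > 0" using pos d by (simp add: e_def)
    have "(C * ?I) * e \<le> (C * ?I + 1) * e" using \<open>e > 0\<close> by simp
    also have "\<dots> = d" using pos by (simp add: e_def)
    finally show "(LINT t|?M. (f t)\<^sup>2) \<le> C * ?I + d"
      using lim[OF \<open>e > 0\<close>] by (simp add: algebra_simps)
  qed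
qed

section \<open>The discrete Hardy inequality\<close>

lemma jacobi_entry_sq:
  assumes lam: "lam > - 1 / 2" and n: "n \<ge> 1"
  shows "(jacobi_entry lam n)\<^sup>2
       = (real n + 1) * (real n + 2 * lam) / (4 * ((real n + lam) * (real n + 1 + lam)))"
proof -
  have "real n \<ge> 1" using n by simp
  then have "(real n + 1) * (real n + 2 * lam) / ((real n + lam) * (real n + 1 + lam)) \<ge> 0"
    using lam by (intro divide_nonneg_nonneg mult_nonneg_nonneg) linarith+
  then show ?thesis by (simp add: jacobi_entry_def power_divide)
qed

lemma jacobi_form_Suc:
  assumes "N \<ge> 1"
  shows "jacobi_form lam b (Suc N)
       = jacobi_form lam b N + (b (Suc N))\<^sup>2 - 2 * (jacobi_entry lam N * b N * b (Suc N))"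
  using assms by (simp add: jacobi_form_def)

text \<open>
  Each cross term is absorbed by \<open>2 \<alpha>\<^sub>n b\<^sub>n b\<^sub>n\<^sub>+\<^sub>1 \<le> k\<^sub>n b\<^sub>n\<^sup>2 + (\<alpha>\<^sub>n\<^sup>2 / k\<^sub>n) b\<^sub>n\<^sub>+\<^sub>1\<^sup>2\<close>, and \<open>V\<^sub>n\<close> is what remains of
  the diagonal. Nothing is lost here for \<open>b\<^sub>n\<^sub>+\<^sub>1 / b\<^sub>n = k\<^sub>n / \<alpha>\<^sub>n\<close>, the ground state that the choice of \<open>k\<close>
  amounts to. The induction carries the surplus \<open>k\<^sub>N b\<^sub>N\<^sup>2\<close> that the next cross term
  uses up.
\<close>

lemma jacobi_form_ground_state_bound:
  assumes k: "\<And>n. n \<ge> 1 \<Longrightarrow> k n > 0"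
    and V1: "V 1 + k 1 \<le> 1"
    and V: "\<And>n. n \<ge> 1 \<Longrightarrow> V (Suc n) + k (Suc n) + (jacobi_entry lam n)\<^sup>2 / k n \<le> 1"
  shows "(\<Sum>n=1..N. V n * (b n)\<^sup>2) \<le> jacobi_form lam b N"
proof -
  have "(\<Sum>n=1..N. V n * (b n)\<^sup>2) + k N * (b N)\<^sup>2 \<le> jacobi_form lam b N" if "N \<ge> 1" for N
    using that
  proof (induction N rule: dec_induct)
    case base
    have "(V 1 + k 1) * (b 1)\<^sup>2 \<le> 1 * (b 1)\<^sup>2" using V1 by (intro mult_right_mono) auto
    then show ?case by (simp add: jacobi_form_def algebra_simps)
  next
    case (step N)
    define j where "j = jacobi_entry lam N"
    have kN: "k N > 0" using k step.hyps by simp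
    have "0 \<le> (k N * b N - j * b (Suc N))\<^sup>2 / k N" using kN by simp
    also have "\<dots> = k N * (b N)\<^sup>2 + j\<^sup>2 / k N * (b (Suc N))\<^sup>2 - 2 * (j * b N * b (Suc N))"
      using kN by (simp add: field_simps power2_eq_square)
    finally have "2 * (j * b N * b (Suc N)) \<le> k N * (b N)\<^sup>2 + j\<^sup>2 / k N * (b (Suc N))\<^sup>2" by simp
    moreover have "(V (Suc N) + k (Suc N) + j\<^sup>2 / k N) * (b (Suc N))\<^sup>2 \<le> 1 * (b (Suc N))\<^sup>2"
      using V[of N] step.hyps by (intro mult_right_mono) (auto simp: j_def)
    ultimately show ?case
      using step by (simp add: jacobi_form_Suc j_def[symmetric] algebra_simps)
  qed
  moreover have "k N * (b N)\<^sup>2 \<ge> 0" if "N \<ge> 1" using k[OF that] by simp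
  ultimately show ?thesis by (cases "N \<ge> 1") (force simp: jacobi_form_def)+
qed

text \<open>
  With \<open>x = n + \<lambda>\<close>, the choice \<open>k\<^sub>n = (x + 1/2) / (2 x)\<close> makes the potential
  \<open>(\<lambda> - 1/2)\<^sup>2 / (2 x (x - 1/2))\<close> for \<open>n \<ge> 2\<close>, because \<open>n (n + 2 \<lambda> - 1) = (x - 1/2)\<^sup>2 - (\<lambda> - 1/2)\<^sup>2\<close>. At
  \<open>n = 1\<close> there is no cross term from below, and the whole of \<open>1 - k\<^sub>1 = (1 + 2 \<lambda>) / (4 (1 + \<lambda>))\<close> is
  available. The two hypotheses on \<open>e\<close> say that these potentials dominate \<open>e / (n (n + 2 \<lambda>))\<close>.
\<close>

lemma jacobi_form_hardy_bound:
  assumes lam: "lam > - 1 / 2" and e0: "e \<ge> 0"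
    and e1: "4 * e * (1 + lam) \<le> (1 + 2 * lam)\<^sup>2"
    and e2: "\<And>n. n \<ge> 2 \<Longrightarrow> 2 * e * ((real n + lam) * (real n + lam - 1 / 2))
                    \<le> (lam - 1 / 2)\<^sup>2 * (real n * (real n + 2 * lam))"
  shows "(\<Sum>n=1..N. e / (real n * (real n + 2 * lam)) * (b n)\<^sup>2) \<le> jacobi_form lam b N"
proof (rule jacobi_form_ground_state_bound)
  define k where "k n = (real n + lam + 1 / 2) / (2 * (real n + lam))" for n
  show "k n > 0" if "n \<ge> 1" for n
  proof -
    have "real n \<ge> 1" using that by simp
    then show ?thesis using lam unfolding k_def by (intro divide_pos_pos mult_pos_pos) linarith+
  qed
  have p: "1 + lam > 0" "1 + 2 * lam > 0" using lam by auto
  have "e / (1 + 2 * lam) \<le> (1 + 2 * lam) / (4 * (1 + lam))"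
    using e1 p by (simp add: field_simps power2_eq_square)
  also have "\<dots> = 1 - k 1"
    using p by (simp add: k_def field_simps)
  finally show "e / (real 1 * (real 1 + 2 * lam)) + k 1 \<le> 1" by simp
  show "e / (real (Suc n) * (real (Suc n) + 2 * lam)) + k (Suc n) + (jacobi_entry lam n)\<^sup>2 / k n \<le> 1"
    if n: "n \<ge> 1" for n
  proof -
    define x where "x = real n + 1 + lam"
    have n1: "real n \<ge> 1" using n by simp
    have x: "x > 3 / 2" using n1 lam by (simp add: x_def)
    have S: "real (Suc n) = real n + 1" by simp
    have "(jacobi_entry lam n)\<^sup>2 / k n
        = ((real n + 1) * (real n + 2 * lam) / (4 * ((x - 1) * x))) / ((x - 1 / 2) / (2 * (x - 1)))"
      unfolding jacobi_entry_sq[OF lam n] k_def x_def by (simp add: algebra_simps)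
    also have "\<dots> = (real n + 1) * (real n + 2 * lam) / (2 * (x * (x - 1 / 2)))"
    proof -
      have "(u / (4 * ((x - 1) * x))) / ((x - 1 / 2) / (2 * (x - 1))) = u / (2 * (x * (x - 1 / 2)))" for u
        using x by (simp add: divide_simps)
      then show ?thesis .
    qed
    also have "(real n + 1) * (real n + 2 * lam) = (x - 1 / 2)\<^sup>2 - (lam - 1 / 2)\<^sup>2"
      by (simp add: x_def power2_eq_square algebra_simps)
    finally have j: "(jacobi_entry lam n)\<^sup>2 / k n
        = ((x - 1 / 2)\<^sup>2 - (lam - 1 / 2)\<^sup>2) / (2 * (x * (x - 1 / 2)))" .
    have kS: "k (Suc n) = (x + 1 / 2) / (2 * x)"
      unfolding k_def x_def S by simp
    have sum: "k (Suc n) + (jacobi_entry lam n)\<^sup>2 / k n = 1 - (lam - 1 / 2)\<^sup>2 / (2 * (x * (x - 1 / 2)))"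
    proof -
      have "(x + 1 / 2) / (2 * x) + ((x - 1 / 2)\<^sup>2 - d) / (2 * (x * (x - 1 / 2))) = 1 - d / (2 * (x * (x - 1 / 2)))" for d
        using x by (simp add: divide_simps) (simp add: power2_eq_square algebra_simps)
      then show ?thesis unfolding j kS .
    qed
    have pn: "real (Suc n) * (real (Suc n) + 2 * lam) > 0"
      using n1 lam by (intro mult_pos_pos) auto
    have px: "2 * (x * (x - 1 / 2)) > 0" using x by simp
    have "2 * e * (x * (x - 1 / 2)) \<le> (lam - 1 / 2)\<^sup>2 * (real (Suc n) * (real (Suc n) + 2 * lam))"
      using e2[of "Suc n"] n unfolding x_def S by simp
    then have "e / (real (Suc n) * (real (Suc n) + 2 * lam)) \<le> (lam - 1 / 2)\<^sup>2 / (2 * (x * (x - 1 / 2)))"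
      using pn px by (simp add: pos_divide_le_eq pos_le_divide_eq mult_ac del: of_nat_Suc)
    then show ?thesis using sum by linarith
  qed
qed

lemma jacobi_hardyI:
  assumes e: "e > 0"
    and "\<And>b N. (\<Sum>n=1..N. e / (real n * (real n + 2 * lam)) * (b n)\<^sup>2) \<le> jacobi_form lam b N"
  shows "jacobi_hardy lam (1 / e)"
  unfolding jacobi_hardy_def
proof (intro allI)
  fix b N
  have "(\<Sum>n=1..N. e / (real n * (real n + 2 * lam)) * (b n)\<^sup>2)
      = e * (\<Sum>n=1..N. (b n)\<^sup>2 / (real n * (real n + 2 * lam)))"
    by (simp add: sum_distrib_left)
  then show "(\<Sum>n=1..N. (b n)\<^sup>2 / (real n * (real n + 2 * lam))) \<le> 1 / e * jacobi_form lam b N"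
    using assms(2)[where b=b and N=N] e by (simp add: field_simps)
qed

text \<open>
  The value of \<open>e\<close> for \<open>n \<ge> 2\<close> comes from \<open>x (x - 1/2) \<le> x\<^sup>2\<close> and from
  \<open>x\<^sup>2 - \<lambda>\<^sup>2 \<ge> (1 - \<lambda>\<^sup>2 / (1 + \<lambda>)\<^sup>2) x\<^sup>2\<close> for \<open>x \<ge> 1 + \<lambda>\<close>, where the last factor is \<open>(1 + 2 \<lambda>) / (1 + \<lambda>)\<^sup>2\<close>.
\<close>

lemma jacobi_hardy_exists:
  assumes lam: "lam > - 1 / 2" "lam \<noteq> 1 / 2"
  shows "\<exists>C>0. jacobi_hardy lam C"
proof -
  define d where "d = (lam - 1 / 2)\<^sup>2"
  define e where "e = min ((1 + 2 * lam)\<^sup>2 / (4 * (1 + lam))) (d * (1 + 2 * lam) / (2 * (1 + lam)\<^sup>2))"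
  have p: "1 + lam > 0" "1 + 2 * lam > 0" "d > 0" using lam by (auto simp: d_def)
  have e: "e > 0" using p by (simp add: e_def)
  have "jacobi_hardy lam (1 / e)"
  proof (rule jacobi_hardyI[OF e jacobi_form_hardy_bound[OF lam(1) less_imp_le[OF e]]])
    have "e \<le> (1 + 2 * lam)\<^sup>2 / (4 * (1 + lam))" by (simp add: e_def)
    then show "4 * e * (1 + lam) \<le> (1 + 2 * lam)\<^sup>2"
      using p by (simp add: pos_le_divide_eq mult_ac)
    fix n :: nat assume n: "n \<ge> 2"
    define x where "x = real n + lam"
    have x: "x \<ge> 1 + lam" "x > 0" using n p by (auto simp: x_def)
    have "2 * e * (x * (x - 1 / 2)) \<le> 2 * e * (x * x)"
      using e x by (intro mult_left_mono) auto
    also have "\<dots> \<le> d * (1 + 2 * lam) / (1 + lam)\<^sup>2 * (x * x)"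
    proof (rule mult_right_mono)
      have "e \<le> d * (1 + 2 * lam) / (2 * (1 + lam)\<^sup>2)" by (simp add: e_def)
      also have "\<dots> = d * (1 + 2 * lam) / (1 + lam)\<^sup>2 / 2" by simp
      finally have "e \<le> d * (1 + 2 * lam) / (1 + lam)\<^sup>2 / 2" .
      moreover have "2 * e \<le> z" if "e \<le> z / 2" for z using that by simp
      ultimately show "2 * e \<le> d * (1 + 2 * lam) / (1 + lam)\<^sup>2" by blast
    qed simp
    also have "\<dots> = d * ((1 + 2 * lam) / (1 + lam)\<^sup>2 * x\<^sup>2)" by (simp add: power2_eq_square)
    also have "(1 + 2 * lam) / (1 + lam)\<^sup>2 * x\<^sup>2 = x\<^sup>2 - lam\<^sup>2 * (x\<^sup>2 / (1 + lam)\<^sup>2)"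
      using p by (simp add: divide_simps) (simp add: power2_eq_square algebra_simps)
    also have "\<dots> \<le> x\<^sup>2 - lam\<^sup>2"
    proof -
      have "(1 + lam)\<^sup>2 \<le> x\<^sup>2" using x p by (intro power_mono) auto
      then have "lam\<^sup>2 * 1 \<le> lam\<^sup>2 * (x\<^sup>2 / (1 + lam)\<^sup>2)"
        using p by (intro mult_left_mono) auto
      then show ?thesis by simp
    qed
    also have "x\<^sup>2 - lam\<^sup>2 = real n * (real n + 2 * lam)"
      by (simp add: x_def power2_eq_square algebra_simps)
    finally show "2 * e * ((real n + lam) * (real n + lam - 1 / 2))
        \<le> (lam - 1 / 2)\<^sup>2 * (real n * (real n + 2 * lam))"
      using p by (simp add: d_def x_def)
  qed
  then show ?thesis using e by (intro exI[of _ "1 / e"]) auto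
qed

text \<open>
  The condition for \<open>n \<ge> 2\<close> with \<open>2 e = (\<lambda> - 1/2)\<^sup>2\<close> is \<open>x (x - 1/2) \<le> x\<^sup>2 - \<lambda>\<^sup>2\<close>, that is \<open>2 \<lambda>\<^sup>2 \<le> x\<close>.
\<close>

lemma jacobi_hardy_optimal_constant:
  assumes lam: "0 \<le> lam" "lam \<le> 1" "lam \<noteq> 1 / 2"
  shows "jacobi_hardy lam (8 / (2 * lam - 1)\<^sup>2)"
proof -
  define e where "e = (lam - 1 / 2)\<^sup>2 / 2"
  have e: "e > 0" using lam by (simp add: e_def)
  have "\<bar>lam - 1 / 2\<bar> \<le> \<bar>1 / 2\<bar>" using lam by linarith
  then have d4: "(lam - 1 / 2)\<^sup>2 \<le> (1 / 2)\<^sup>2" by (simp only: abs_le_square_iff)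
  have "jacobi_hardy lam (1 / e)"
  proof (rule jacobi_hardyI[OF e jacobi_form_hardy_bound[OF _ less_imp_le[OF e]]])
    show "lam > - 1 / 2" using lam by simp
    have "4 * e * (1 + lam) \<le> 4 * (1 / 8) * 2"
      using e lam d4 by (intro mult_mono) (auto simp: e_def power2_eq_square)
    also have "\<dots> \<le> (1 + 2 * lam)\<^sup>2" using lam by (simp add: power2_eq_square algebra_simps)
    finally show "4 * e * (1 + lam) \<le> (1 + 2 * lam)\<^sup>2" .
    fix n :: nat assume "n \<ge> 2"
    then have "real n \<ge> 2" by simp
    moreover have "lam * lam \<le> 1 * lam" using lam by (intro mult_right_mono) auto
    ultimately have "(real n + lam) * (real n + lam - 1 / 2) \<le> real n * (real n + 2 * lam)"
      using lam by (simp add: algebra_simps)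
    then have "2 * e * ((real n + lam) * (real n + lam - 1 / 2)) \<le> 2 * e * (real n * (real n + 2 * lam))"
      using e by (intro mult_left_mono) auto
    then show "2 * e * ((real n + lam) * (real n + lam - 1 / 2))
        \<le> (lam - 1 / 2)\<^sup>2 * (real n * (real n + 2 * lam))" by (simp add: e_def)
  qed
  moreover have "1 / e = 8 / (2 * lam - 1)\<^sup>2"
  proof -
    have "2 * lam - 1 \<noteq> 0" "lam - 1 / 2 \<noteq> 0" using lam by auto
    have "(2 * lam - 1)\<^sup>2 = 8 * e" by (simp add: e_def power2_eq_square algebra_simps)
    then show ?thesis using e by (simp add: field_simps)
  qed
  ultimately show ?thesis by simp
qed

section \<open>Lower bound for the constant in the discrete inequality\<close>

text \<open>
  The expansion \<open>\<surd>(y\<^sup>2 - s) = y - s / (2 y) + O(y\<^sup>-\<^sup>3)\<close>; an error of order \<open>y\<^sup>-\<^sup>2\<close> is summable and therefore good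
  enough.
\<close>

lemma sqrt_lower_bound:
  fixes y s :: real
  assumes y: "y \<ge> 1" and s: "0 \<le> s" "s \<le> 1 / 4"
  shows "y - s / (2 * y) - s / (8 * y\<^sup>2) \<le> sqrt (y\<^sup>2 - s)"
proof (rule real_le_rsqrt)
  define u where "u = s / (2 * y) + s / (8 * y\<^sup>2)"
  have y2: "y \<le> y\<^sup>2" using y by (simp add: power2_eq_square)
  have u0: "0 \<le> u" using y s by (simp add: u_def)
  have "s / (8 * y\<^sup>2) \<le> s / (8 * y)"
    using y y2 s by (intro divide_left_mono) auto
  then have "u \<le> 5 / 8 * (s / y)" by (simp add: u_def)
  then have "u\<^sup>2 \<le> (5 / 8 * (s / y))\<^sup>2" using u0 by (intro power_mono) auto
  also have "\<dots> = 25 / 64 * (s * (s / y\<^sup>2))" by (simp add: power2_eq_square)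
  also have "\<dots> \<le> 25 / 64 * (1 / 4 * (s / y))"
    using y y2 s by (intro mult_left_mono mult_mono divide_left_mono) auto
  also have "\<dots> \<le> s / (4 * y)"
  proof -
    have "0 \<le> s / y" using y s by simp
    moreover have "s / (4 * y) = s / y / 4" by simp
    ultimately show ?thesis by linarith
  qed
  also have "\<dots> = 2 * y * u - s" using y by (simp add: u_def field_simps power2_eq_square)
  finally have "(y - u)\<^sup>2 \<le> y\<^sup>2 - s" by (simp add: power2_diff)
  then show "(y - s / (2 * y) - s / (8 * y\<^sup>2))\<^sup>2 \<le> y\<^sup>2 - s"
    by (simp add: u_def diff_diff_eq)
qed

text \<open>
  The entries \<open>\<alpha>\<^sub>n \<surd>(n + \<lambda>) \<surd>(n + 1 + \<lambda>)\<close> of the Jacobi matrix after the substitution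
  \<open>b\<^sub>n = \<surd>(n + \<lambda>) \<phi>\<^sub>n\<close>, which clears the denominators below the root.
\<close>

definition gauge_weight :: "real \<Rightarrow> nat \<Rightarrow> real" where
  "gauge_weight lam n = sqrt ((real n + 1) * (real n + 2 * lam)) / 2"

lemma gauge_weight_eq:
  assumes lam: "lam > - 1 / 2" and n: "n \<ge> 1"
  shows "gauge_weight lam n = jacobi_entry lam n * sqrt (real n + lam) * sqrt (real (Suc n) + lam)"
proof -
  have "real n \<ge> 1" using n by simp
  then have p: "real n + lam > 0" "real n + 1 + lam > 0" using lam by linarith+
  have "sqrt (u / (x * z)) / 2 * sqrt x * sqrt z = sqrt u / 2" if "x > 0" "z > 0" for u x z :: real
    using that by (simp add: real_sqrt_divide real_sqrt_mult)
  from this[OF p] have "jacobi_entry lam n * sqrt (real n + lam) * sqrt (real n + 1 + lam)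
      = gauge_weight lam n"
    by (simp only: jacobi_entry_def gauge_weight_def)
  moreover have "real (Suc n) + lam = real n + 1 + lam" by simp
  ultimately show ?thesis by presburger
qed

text \<open>
  In this gauge the form splits into a potential part and a discrete Dirichlet form, by
  \<open>- 2 \<phi>\<^sub>n \<phi>\<^sub>n\<^sub>+\<^sub>1 = (\<phi>\<^sub>n - \<phi>\<^sub>n\<^sub>+\<^sub>1)\<^sup>2 - \<phi>\<^sub>n\<^sup>2 - \<phi>\<^sub>n\<^sub>+\<^sub>1\<^sup>2\<close>. The boundary term at \<open>N\<close> vanishes for the cutoffs
  to which this is applied.
\<close>

lemma jacobi_form_gauge:
  assumes lam: "lam > - 1 / 2" and N: "N \<ge> 1"
  shows "jacobi_form lam (\<lambda>n. sqrt (real n + lam) * ph n) N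
       = (\<Sum>n=1..N. (real n + lam - gauge_weight lam n - (if n = 1 then 0 else gauge_weight lam (n - 1)))
                       * (ph n)\<^sup>2)
         + (\<Sum>n=1..<N. gauge_weight lam n * (ph n - ph (Suc n))\<^sup>2) + gauge_weight lam N * (ph N)\<^sup>2"
  using N
proof (induction N rule: dec_induct)
  case base
  then show ?case using lam by (simp add: jacobi_form_def power_mult_distrib algebra_simps)
next
  case (step N)
  let ?w = "gauge_weight lam N"
  let ?b = "\<lambda>n. sqrt (real n + lam) * ph n"
  have p: "real (Suc N) + lam \<ge> 0" using lam by simp
  have "jacobi_entry lam N * ?b N * ?b (Suc N) = ?w * (ph N * ph (Suc N))"
    unfolding gauge_weight_eq[OF lam step.hyps(1)] by (simp only: mult_ac)
  moreover have "(?b (Suc N))\<^sup>2 = (real (Suc N) + lam) * (ph (Suc N))\<^sup>2"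
    using p by (simp only: power_mult_distrib real_sqrt_pow2)
  ultimately have "jacobi_form lam ?b (Suc N)
      = jacobi_form lam ?b N + (real (Suc N) + lam) * (ph (Suc N))\<^sup>2 - 2 * (?w * (ph N * ph (Suc N)))"
    using jacobi_form_Suc[OF step.hyps(1), of lam ?b] by presburger
  moreover have "Suc N \<noteq> 1" using step.hyps by simp
  ultimately show ?case
    using step by (simp add: power2_diff algebra_simps)
qed

text \<open>
  Let \<open>n \<ge> 2\<close> and \<open>x = n + \<lambda>\<close>. The gauge weight at \<open>n\<close> is half the root of \<open>(x + 1/2)\<^sup>2 - (\<lambda> - 1/2)\<^sup>2\<close>, and at \<open>n - 1\<close>
  half the root of \<open>(x - 1/2)\<^sup>2 - (\<lambda> - 1/2)\<^sup>2\<close>. The leading terms cancel against \<open>x\<close>, and the terms of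
  order \<open>1 / x\<close> add up to the critical Hardy potential.
\<close>

lemma gauge_potential_bound:
  assumes lam: "0 \<le> lam" "lam \<le> 1" and n: "n \<ge> 1"
  shows "real n + lam - gauge_weight lam n - (if n = 1 then 0 else gauge_weight lam (n - 1))
       \<le> (lam - 1 / 2)\<^sup>2 / 2 * ((real n + lam) / (real n * (real n + 2 * lam))) + 2 / (real n)\<^sup>2"
proof (cases "n = 1")
  case True
  have "gauge_weight lam n \<ge> 0" using lam by (simp add: gauge_weight_def)
  moreover define T where "T = (lam - 1 / 2)\<^sup>2 / 2 * ((real n + lam) / (real n * (real n + 2 * lam)))"
  have "0 \<le> T" using lam by (simp add: T_def)
  moreover have "2 / (real n)\<^sup>2 = 2" "real n = 1" using True by simp_all
  ultimately show ?thesis using True lam unfolding T_def[symmetric] by simp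
next
  case False
  then have n2: "real n \<ge> 2" using n by simp
  define x where "x = real n + lam"
  define s where "s = (lam - 1 / 2)\<^sup>2"
  have "\<bar>lam - 1 / 2\<bar> \<le> \<bar>1 / 2\<bar>" using lam by linarith
  then have "(lam - 1 / 2)\<^sup>2 \<le> (1 / 2)\<^sup>2" by (simp only: abs_le_square_iff)
  then have s: "0 \<le> s" "s \<le> 1 / 4" by (auto simp: s_def power2_eq_square)
  have x: "x \<ge> 2" "x \<ge> real n" using n2 lam by (auto simp: x_def)
  have w1: "gauge_weight lam n = sqrt ((x + 1 / 2)\<^sup>2 - s) / 2"
    unfolding gauge_weight_def
    by (rule arg_cong[of _ _ "\<lambda>z. sqrt z / 2"]) (simp add: x_def s_def power2_eq_square algebra_simps)
  have "real (n - 1) = real n - 1" using n by simp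
  then have w2: "gauge_weight lam (n - 1) = sqrt ((x - 1 / 2)\<^sup>2 - s) / 2"
    unfolding gauge_weight_def
    by (intro arg_cong[of _ _ "\<lambda>z. sqrt z / 2"]) (simp add: x_def s_def power2_eq_square algebra_simps)
  have b1: "(x + 1 / 2) - s / (2 * (x + 1 / 2)) - s / (8 * (x + 1 / 2)\<^sup>2) \<le> sqrt ((x + 1 / 2)\<^sup>2 - s)"
    and b2: "(x - 1 / 2) - s / (2 * (x - 1 / 2)) - s / (8 * (x - 1 / 2)\<^sup>2) \<le> sqrt ((x - 1 / 2)\<^sup>2 - s)"
    using x by (intro sqrt_lower_bound s; simp)+
  have yn: "real n / 2 \<le> x - 1 / 2" "real n / 2 \<le> x + 1 / 2" using x n2 by linarith+
  have err: "s / (8 * y\<^sup>2) \<le> (1 / 8) / (real n)\<^sup>2" if "real n / 2 \<le> y" for y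
  proof -
    have "(real n / 2)\<^sup>2 \<le> y\<^sup>2" using that by (intro power_mono) auto
    then have "s / (8 * y\<^sup>2) \<le> (1 / 4) / (8 * (real n / 2)\<^sup>2)"
      using s n2 by (intro frac_le) auto
    then show ?thesis by (simp add: power_divide)
  qed
  have e1: "s / (8 * (x + 1 / 2)\<^sup>2) \<le> (1 / 8) / (real n)\<^sup>2" by (rule err[OF yn(2)])
  have e2: "s / (8 * (x - 1 / 2)\<^sup>2) \<le> (1 / 8) / (real n)\<^sup>2" by (rule err[OF yn(1)])
  have main: "s / (2 * (x + 1 / 2)) + s / (2 * (x - 1 / 2)) \<le> s / x + 1 / (real n)\<^sup>2"
  proof -
    have pos: "x + 1 / 2 > 0" "x - 1 / 2 > 0" "x > 0" using x by auto
    have q: "x * ((x + 1 / 2) * (x - 1 / 2)) \<ge> (real n)\<^sup>2"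
    proof -
      have "(x + 1 / 2) * (x - 1 / 2) \<ge> (2 + 1 / 2) * (x - 1 / 2)"
        using x by (intro mult_right_mono) auto
      moreover have "(2 + 1 / 2) * (x - 1 / 2) \<ge> x" using x by (simp add: field_simps)
      ultimately have "(x + 1 / 2) * (x - 1 / 2) \<ge> x" by (rule order_trans[rotated])
      then have "x * ((x + 1 / 2) * (x - 1 / 2)) \<ge> x * x" using x by (intro mult_left_mono) auto
      also have "x * x \<ge> (real n)\<^sup>2" unfolding power2_eq_square using x by (intro mult_mono) auto
      finally show ?thesis .
    qed
    have "s / (2 * (x + 1 / 2)) + s / (2 * (x - 1 / 2)) = s / x + (s / 4) / (x * ((x + 1 / 2) * (x - 1 / 2)))"
      using pos by (simp add: divide_simps) (simp add: algebra_simps)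
    also have "\<dots> \<le> s / x + 1 / (real n)\<^sup>2"
      using q s n2 by (intro add_left_mono frac_le) auto
    finally show ?thesis .
  qed
  have last: "s / 2 * (1 / x) \<le> s / 2 * (x / (real n * (real n + 2 * lam)))"
  proof (rule mult_left_mono)
    have "real n * (real n + 2 * lam) \<le> x * x" by (simp add: x_def algebra_simps)
    moreover have "real n * (real n + 2 * lam) > 0" using n2 lam by (intro mult_pos_pos) auto
    ultimately show "1 / x \<le> x / (real n * (real n + 2 * lam))"
      using x by (simp add: divide_simps)
  qed (use s in simp)
  have "x - gauge_weight lam n - gauge_weight lam (n - 1)
      \<le> s / 2 * (1 / x) + 2 / (real n)\<^sup>2"
  proof -
    define z where "z = 1 / (real n)\<^sup>2"
    have z: "0 \<le> z" "(1 / 8) / (real n)\<^sup>2 = z / 8" "2 / (real n)\<^sup>2 = 2 * z" "s / 2 * (1 / x) = s / x / 2"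
      by (simp_all add: z_def)
    have "x - W1 / 2 - W2 / 2 \<le> r / 2 + 2 * z"
      if "x + 1 / 2 - A - E1 \<le> W1" "x - 1 / 2 - B - E2 \<le> W2" "E1 \<le> z / 8" "E2 \<le> z / 8" "A + B \<le> r + z"
      for W1 W2 A B E1 E2 r :: real using that z(1) by linarith
    from this[OF b1 b2 e1[unfolded z(2)] e2[unfolded z(2)] main[folded z_def]]
    show ?thesis unfolding w1 w2 z(3,4) .
  qed
  then show ?thesis using last False unfolding x_def s_def by simp
qed

lemma sum_inverse_squares_le: "(\<Sum>n=1..N. 2 / (real n)\<^sup>2) \<le> 4"
proof -
  have "(\<Sum>n=1..N. 2 / (real n)\<^sup>2) \<le> 4 - 2 / real N" if "N \<ge> 1" for N
    using that
  proof (induction N rule: dec_induct)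
    case (step N)
    define m where "m = real N"
    have m: "m \<ge> 1" using step.hyps by (simp add: m_def)
    have "2 / (m + 1)\<^sup>2 \<le> 2 / m - 2 / (m + 1)"
      using m by (simp add: divide_simps) (simp add: power2_eq_square algebra_simps)
    then show ?case using step.IH by (simp add: m_def add.commute)
  qed simp
  from this[of N] have "N \<ge> 1 \<Longrightarrow> ?thesis"
    using divide_nonneg_nonneg[of 2 "real N"] by linarith
  then show ?thesis by (cases "N = 0") simp_all
qed

text \<open>
  The test sequence is \<open>b\<^sub>n = \<surd>(n + \<lambda>) \<phi>\<^sub>n\<close> with the logarithmic cutoff \<open>\<phi>\<^sub>n = 1 - H\<^sub>n / H\<^sub>M\<close>, where \<open>H\<close>
  are the harmonic numbers. The Dirichlet part is at most
  \<open>\<Sum> (n + 1) / ((n + 1) H\<^sub>M)\<^sup>2 \<le> 1 / H\<^sub>M \<le> 1\<close>. So with \<open>S\<close> the Hardy sum and \<open>e = (\<lambda> - 1/2)\<^sup>2 / 2\<close>, the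
  inequality says \<open>S \<le> C (e S + 5)\<close>, where \<open>5\<close> is the bound \<open>4\<close> for the sum of the errors \<open>2 / n\<^sup>2\<close>
  plus the Dirichlet part. If \<open>C e < 1\<close>, this bounds \<open>S\<close> independently of \<open>M\<close>; but as \<open>M\<close>
  grows, \<open>\<phi>\<^sub>n \<rightarrow> 1\<close> for each \<open>n\<close>, and \<open>S\<close> would bound the harmonic series.
\<close>

lemma jacobi_hardy_constant_lower_bound:
  assumes lam: "0 \<le> lam" "lam \<le> 1" and H: "jacobi_hardy lam C"
  shows "8 \<le> C * (2 * lam - 1)\<^sup>2"
proof (rule ccontr)
  assume "\<not> 8 \<le> C * (2 * lam - 1)\<^sup>2"
  define e where "e = (lam - 1 / 2)\<^sup>2 / 2"
  have "(2 * lam - 1)\<^sup>2 = 8 * e" by (simp add: e_def power2_eq_square algebra_simps)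
  with \<open>\<not> 8 \<le> _\<close> have eta: "1 - C * e > 0" by simp
  have lam': "lam > - 1 / 2" using lam by simp
  \<comment> \<open>The sign of \<open>C\<close> matters because \<open>C\<close> will multiply an upper bound for the form.\<close>
  have C: "C > 0"
  proof -
    have "(\<Sum>n=1..1. (1::real)\<^sup>2 / (real n * (real n + 2 * lam))) \<le> C * jacobi_form lam (\<lambda>_. 1) 1"
      using H[unfolded jacobi_hardy_def, rule_format, where b="\<lambda>_. 1" and N=1] by simp
    then have "1 / (1 + 2 * lam) \<le> C" by (simp add: jacobi_form_def)
    moreover have "0 < 1 / (1 + 2 * lam)" using lam by simp
    ultimately show ?thesis by (rule less_le_trans[rotated])
  qed
  define ph where "ph M n = 1 - harm n / (harm M :: real)" for M n
  \<comment> \<open>The constant is twice the bound \<open>5 C / (1 - C e)\<close> for \<open>S\<close>, since \<open>(n + \<lambda>) / (n + 2 \<lambda>) \<ge> 1/2\<close>.\<close>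
  have key: "(\<Sum>n=1..M. (ph M n)\<^sup>2 / real n) \<le> 10 * C / (1 - C * e)" if M: "M \<ge> 1" for M
  proof -
    let ?b = "\<lambda>n. sqrt (real n + lam) * ph M n"
    define S where "S = (\<Sum>n=1..M. (?b n)\<^sup>2 / (real n * (real n + 2 * lam)))"
    have hM: "harm M \<ge> (1 :: real)" using harm_mono[OF M, where ?'a = real] by (simp add: harm_expand)
    have S_eq: "S = (\<Sum>n=1..M. (real n + lam) / (real n * (real n + 2 * lam)) * (ph M n)\<^sup>2)"
      unfolding S_def using lam by (intro sum.cong refl) (simp add: power_mult_distrib)
    have phM: "ph M M = 0" using hM by (simp add: ph_def)
    define pot where "pot n = real n + lam - gauge_weight lam n - (if n = 1 then 0 else gauge_weight lam (n - 1))" for n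
    define U R where "U = (\<Sum>n=1..M. pot n * (ph M n)\<^sup>2)"
      and "R = (\<Sum>n=1..<M. gauge_weight lam n * (ph M n - ph M (Suc n))\<^sup>2)"
    have form: "jacobi_form lam ?b M = U + R"
      using jacobi_form_gauge[OF lam' M, of "ph M"] phM by (simp add: U_def R_def pot_def)
    have U: "U \<le> e * S + 4"
    proof -
      have "U \<le> (\<Sum>n=1..M. e * ((real n + lam) / (real n * (real n + 2 * lam)) * (ph M n)\<^sup>2) + 2 / (real n)\<^sup>2)"
        unfolding U_def
      proof (rule sum_mono)
        fix n assume n: "n \<in> {1..M}"
        have "harm n \<le> (harm M :: real)" using n by (intro harm_mono) auto
        then have "0 \<le> ph M n" "ph M n \<le> 1" using hM M by (simp_all add: ph_def harm_nonneg pos_divide_le_eq)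
        then have p1: "(ph M n)\<^sup>2 \<le> 1" by (simp add: power_le_one)
        have "pot n * (ph M n)\<^sup>2
            \<le> (e * ((real n + lam) / (real n * (real n + 2 * lam))) + 2 / (real n)\<^sup>2) * (ph M n)\<^sup>2"
        proof (rule mult_right_mono)
          show "pot n \<le> e * ((real n + lam) / (real n * (real n + 2 * lam))) + 2 / (real n)\<^sup>2"
            unfolding pot_def e_def by (rule gauge_potential_bound[OF lam]) (use n in simp)
        qed simp
        also have "\<dots> = e * ((real n + lam) / (real n * (real n + 2 * lam)) * (ph M n)\<^sup>2)
            + 2 / (real n)\<^sup>2 * (ph M n)\<^sup>2" by (simp add: distrib_right mult.assoc)
        also have "\<dots> \<le> e * ((real n + lam) / (real n * (real n + 2 * lam)) * (ph M n)\<^sup>2)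
            + 2 / (real n)\<^sup>2 * 1"
          by (rule add_left_mono, rule mult_left_mono[OF p1]) simp
        finally show "pot n
             * (ph M n)\<^sup>2
            \<le> e * ((real n + lam) / (real n * (real n + 2 * lam)) * (ph M n)\<^sup>2) + 2 / (real n)\<^sup>2" by simp
      qed
      also have "\<dots> = e * S + (\<Sum>n=1..M. 2 / (real n)\<^sup>2)"
        unfolding S_eq by (simp only: sum.distrib sum_distrib_left)
      finally show ?thesis using sum_inverse_squares_le[of M] by linarith
    qed
    have R: "R \<le> 1"
    proof -
      have "R \<le> (\<Sum>n=1..<M. inverse (real (Suc n)) / (harm M)\<^sup>2)"
        unfolding R_def
      proof (rule sum_mono)
        fix n assume "n \<in> {1..<M}"
        have "(real n + 1) * (real n + 2 * lam) \<le> (real n + 1) * (4 * (real n + 1))"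
          using lam by (intro mult_left_mono) auto
        also have "\<dots> = (2 * (real n + 1))\<^sup>2"
          by (simp add: power2_eq_square algebra_simps)
        finally have "sqrt ((real n + 1) * (real n + 2 * lam)) \<le> 2 * (real n + 1)"
          by (intro real_le_lsqrt) auto
        then have w: "gauge_weight lam n \<le> real n + 1"
          by (simp add: gauge_weight_def)
        have "ph M n - ph M (Suc n) = 1 / ((real n + 1) * harm M)"
        proof -
          have "1 - h / H - (1 - (h + inverse m) / H) = 1 / (m * H)" if "m > 0" "H > 0" for h H m :: real
            using that by (simp add: field_simps)
          from this[of "real n + 1" "harm M" "harm n"] hM M show ?thesis
            by (simp add: ph_def harm_Suc add.commute)
        qed
        then have "gauge_weight lam n * (ph M n - ph M (Suc n))\<^sup>2
            \<le> (real n + 1) * (1 / ((real n + 1) * harm M))\<^sup>2"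
          by (simp only: mult_right_mono[OF w] zero_le_power2)
        also have "\<dots> = inverse (real (Suc n)) / (harm M)\<^sup>2"
        proof -
          have "m * (1 / (m * H))\<^sup>2 = inverse m / H\<^sup>2" if "m > 0" for m H :: real
            using that by (simp add: power2_eq_square divide_simps)
          from this[of "real n + 1" "harm M"] show ?thesis by (simp add: add.commute)
        qed
        finally show "gauge_weight lam n * (ph M n - ph M (Suc n))\<^sup>2 \<le> inverse (real (Suc n)) / (harm M)\<^sup>2" .
      qed
      also have "\<dots> \<le> (\<Sum>n<M. inverse (real (Suc n)) / (harm M)\<^sup>2)"
        by (intro sum_mono2) auto
      also have "\<dots> = 1 / harm M"
        using hM by (simp add: harm_altdef sum_divide_distrib[symmetric] power2_eq_square)
      also have "\<dots> \<le> 1" using hM M by (simp add: pos_divide_le_eq)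
      finally show ?thesis .
    qed
    have "jacobi_form lam ?b M \<le> e * S + 5" using form U R by simp
    moreover have "S \<le> C * jacobi_form lam ?b M"
      unfolding S_def by (rule H[unfolded jacobi_hardy_def, THEN spec, THEN spec, of ?b M])
    ultimately have "S \<le> C * (e * S + 5)"
      using mult_left_mono[OF _ less_imp_le[OF C]] order_trans by blast
    then have "S * (1 - C * e) \<le> 5 * C" by (simp add: algebra_simps)
    then have S_le: "S \<le> 5 * C / (1 - C * e)" by (simp only: pos_le_divide_eq[OF eta])
    have "(\<Sum>n=1..M. (ph M n)\<^sup>2 / real n) \<le> 2 * S"
      unfolding S_eq sum_distrib_left
    proof (rule sum_mono)
      fix n assume "n \<in> {1..M}"
      then have n: "real n \<ge> 1" by simp
      have "1 / real n \<le> 2 * ((real n + lam) / (real n * (real n + 2 * lam)))"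
        using n lam by (simp add: divide_simps)
      then have "1 / real n * (ph M n)\<^sup>2 \<le> 2 * ((real n + lam) / (real n * (real n + 2 * lam))) * (ph M n)\<^sup>2"
        by (intro mult_right_mono) auto
      then show "(ph M n)\<^sup>2 / real n \<le> 2 * ((real n + lam) / (real n * (real n + 2 * lam)) * (ph M n)\<^sup>2)"
        by (simp only: mult.assoc mult_1 times_divide_eq_left)
    qed
    then show ?thesis using S_le by simp
  qed
  have "harm N \<le> (10 * C / (1 - C * e) :: real)" for N
  proof (rule LIMSEQ_le_const2)
    have ph1: "(\<lambda>M. ph M n) \<longlonglongrightarrow> 1" for n
    proof -
      have "(\<lambda>M. harm n / (harm M :: real)) \<longlonglongrightarrow> 0"
        by (rule tendsto_divide_0[OF tendsto_const filterlim_at_top_imp_at_infinity[OF harm_at_top]])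
      from tendsto_diff[OF tendsto_const this, of 1] show ?thesis by (simp add: ph_def)
    qed
    have "(\<lambda>M. \<Sum>n=1..N. (ph M n)\<^sup>2 / real n) \<longlonglongrightarrow> (\<Sum>n=1..N. 1\<^sup>2 / real n)"
      by (intro tendsto_sum tendsto_divide tendsto_power ph1 tendsto_const) auto
    then show "(\<lambda>M. \<Sum>n=1..N. (ph M n)\<^sup>2 / real n) \<longlonglongrightarrow> harm N"
      by (simp add: harm_def inverse_eq_divide)
    have "(\<Sum>n=1..N. (ph M n)\<^sup>2 / real n) \<le> 10 * C / (1 - C * e)" if "M \<ge> max 1 N" for M
    proof -
      have "(\<Sum>n=1..N. (ph M n)\<^sup>2 / real n) \<le> (\<Sum>n=1..M. (ph M n)\<^sup>2 / real n)"
        using that by (intro sum_mono2) auto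
      then show ?thesis using key[of M] that by simp
    qed
    then show "\<exists>M0. \<forall>M\<ge>M0. (\<Sum>n=1..N. (ph M n)\<^sup>2 / real n) \<le> 10 * C / (1 - C * e)" by blast
  qed
  moreover have "eventually (\<lambda>N. harm N > (10 * C / (1 - C * e) :: real)) sequentially"
    using harm_at_top by (simp add: filterlim_at_top_dense)
  then obtain N where "harm N > 10 * C / (1 - C * e)"
    using eventually_happens'[OF sequentially_bot] by blast
  ultimately show False by (simp add: leD)
qed

section \<open>Transfer to complex-valued functions\<close>

lemma L2_gegen_parts:
  assumes lam: "lam > - 1 / 2" and f: "f \<in> L2_gegen lam"
  shows "square_integrable (gegen_measure lam) (\<lambda>t. Re (f t))"
    and "square_integrable (gegen_measure lam) (\<lambda>t. Im (f t))"
proof -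
  have fm[measurable]: "f \<in> borel_measurable (lebesgue_on {-1..1})" using f by (simp add: L2_gegen_def)
  have n2: "(\<lambda>t. (norm (f t))\<^sup>2) \<in> borel_measurable (lebesgue_on {-1..1})" by measurable
  have int: "integrable (gegen_measure lam) (\<lambda>t. (norm (f t))\<^sup>2)"
    using f unfolding gegen_measure_integral(1)[OF lam n2] by (simp add: L2_gegen_def)
  have m: "(\<lambda>t. Re (f t)) \<in> borel_measurable (gegen_measure lam)"
    "(\<lambda>t. Im (f t)) \<in> borel_measurable (gegen_measure lam)"
    unfolding gegen_measure_measurable by measurable
  have "integrable (gegen_measure lam) (\<lambda>t. (Re (f t))\<^sup>2)"
    by (rule Bochner_Integration.integrable_bound[OF int]) (use m in \<open>auto simp: cmod_power2\<close>)
  moreover have "integrable (gegen_measure lam) (\<lambda>t. (Im (f t))\<^sup>2)"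
    by (rule Bochner_Integration.integrable_bound[OF int]) (use m in \<open>auto simp: cmod_power2\<close>)
  ultimately show "square_integrable (gegen_measure lam) (\<lambda>t. Re (f t))"
    "square_integrable (gegen_measure lam) (\<lambda>t. Im (f t))"
    using m by (auto simp: square_integrable_def)
qed

lemma gegen_coeff_parts:
  assumes lam: "lam > - 1 / 2" and f: "f \<in> L2_gegen lam"
  shows "gegen_coeff lam f n = Complex (gegen_rcoeff lam (\<lambda>t. Re (f t)) n) (gegen_rcoeff lam (\<lambda>t. Im (f t)) n)"
proof -
  let ?p = "poly (orthonormal_gegen_poly lam n)" and ?M = "gegen_measure lam"
  note parts = L2_gegen_parts[OF lam f]
  have fm[measurable]: "f \<in> borel_measurable (lebesgue_on {-1..1})" using f by (simp add: L2_gegen_def)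
  have pm[measurable]: "?p \<in> borel_measurable (lebesgue_on {-1..1})"
    by (rule continuous_imp_measurable_on_sets_lebesgue) (auto intro!: continuous_intros)
  have fp: "(\<lambda>t. f t * of_real (?p t)) \<in> borel_measurable (lebesgue_on {-1..1})" by measurable
  have re: "integrable ?M (\<lambda>t. Re (f t) * ?p t)" and im: "integrable ?M (\<lambda>t. Im (f t) * ?p t)"
    using square_integrable_mult[OF parts(1) square_integrable_poly[OF lam]]
      square_integrable_mult[OF parts(2) square_integrable_poly[OF lam]] by auto
  have eq: "f t * of_real (?p t) = of_real (Re (f t) * ?p t) + \<i> * of_real (Im (f t) * ?p t)" for t
    by (simp add: complex_eq_iff)
  have "gegen_coeff lam f n = (LINT t|?M. f t * of_real (?p t))"
    unfolding gegen_coeff_def by (rule gegen_measure_integral(2)[OF lam fp, symmetric])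
  also have "\<dots> = (LINT t|?M. of_real (Re (f t) * ?p t)) + (LINT t|?M. \<i> * of_real (Im (f t) * ?p t))"
    unfolding eq using re im
    by (intro Bochner_Integration.integral_add integrable_mult_right integrable_of_real)
  also have "\<dots> = of_real (LINT t|?M. Re (f t) * ?p t) + \<i> * of_real (LINT t|?M. Im (f t) * ?p t)"
    by (simp only: integral_mult_right_zero integral_complex_of_real)
  finally show ?thesis by (simp add: gegen_rcoeff_def complex_eq_iff)
qed

lemma weighted_norm_integral:
  assumes lam: "lam > - 1 / 2" and f: "f \<in> L2_gegen lam"
    and h: "continuous_on {-1..1} h" "\<And>t. t \<in> {-1..1} \<Longrightarrow> \<bar>h t\<bar> \<le> B"
  shows "gegen_const lam * (LINT t|lebesgue_on {-1..1}. h t * (norm (f t))\<^sup>2 * gegen_weight lam t)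
       = (LINT t|gegen_measure lam. h t * (Re (f t))\<^sup>2) + (LINT t|gegen_measure lam. h t * (Im (f t))\<^sup>2)"
proof -
  let ?M = "gegen_measure lam"
  note parts = L2_gegen_parts[OF lam f]
  have fm[measurable]: "f \<in> borel_measurable (lebesgue_on {-1..1})" using f by (simp add: L2_gegen_def)
  have hm[measurable]: "h \<in> borel_measurable (lebesgue_on {-1..1})"
    by (rule continuous_imp_measurable_on_sets_lebesgue[OF h(1)]) auto
  have m: "(\<lambda>t. h t * (norm (f t))\<^sup>2) \<in> borel_measurable (lebesgue_on {-1..1})" by measurable
  have hM: "h \<in> borel_measurable ?M" by (simp add: gegen_measure_measurable)
  have "integrable ?M (\<lambda>t. h t * (Re (f t))\<^sup>2)" "integrable ?M (\<lambda>t. h t * (Im (f t))\<^sup>2)"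
    using square_integrable_bounded_mult[OF parts(1) hM, of B]
      square_integrable_bounded_mult[OF parts(2) hM, of B] h(2)
    by (auto simp: space_gegen_measure)
  then have "(LINT t|?M. h t * (norm (f t))\<^sup>2)
      = (LINT t|?M. h t * (Re (f t))\<^sup>2) + (LINT t|?M. h t * (Im (f t))\<^sup>2)"
    by (simp add: cmod_power2 distrib_left)
  then show ?thesis using gegen_measure_integral(2)[OF lam m] by simp
qed

lemma orthonormal_gegen_poly_0:
  assumes lam: "lam > - 1 / 2"
  shows "orthonormal_gegen_poly lam 0 = 1"
proof -
  have "gegen_poly lam 0 = 1" by (simp add: gegen_poly_def)
  then show ?thesis
    using gegen_mean_1[OF lam] by (simp add: orthonormal_gegen_poly_eq[OF lam] gegen_sqnorm_def)
qed

text \<open>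
  The coefficients of the real and imaginary parts are the real and imaginary parts of the
  coefficients, so the real inequality applies to both parts separately.
\<close>

lemma jacobi_hardy_imp_gegen_ineq:
  assumes lam: "lam > - 1 / 2" and H: "jacobi_hardy lam C" and C: "C \<ge> 0"
  shows "gegen_ineq lam C"
  unfolding gegen_ineq_def
proof (intro allI impI)
  fix f g assume "f \<in> L2_gegen lam \<inter> W2_gegen lam 1"
    and mean0: "(LINT t|lebesgue_on {-1..1}. f t * of_real (gegen_weight lam t)) = 0"
    and fg: "is_neg_gegen_op_powr lam (1 / 2) f g"
  then have f: "f \<in> L2_gegen lam" and g: "g \<in> L2_gegen lam" and g0: "gegen_coeff lam g 0 = 0"
    and gn: "\<And>n. n \<ge> 1 \<Longrightarrow> gegen_coeff lam g n
        = of_real ((real n * (real n + 2 * lam)) powr (1 / 2)) * gegen_coeff lam f n"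
    by (auto simp: is_neg_gegen_op_powr_def)
  have f0: "gegen_coeff lam f 0 = 0"
    using mean0 by (simp add: gegen_coeff_def orthonormal_gegen_poly_0[OF lam])
  note fparts = L2_gegen_parts[OF lam f] and gparts = L2_gegen_parts[OF lam g]
  note fc = gegen_coeff_parts[OF lam f] and gc = gegen_coeff_parts[OF lam g]
  have sq: "gegen_rcoeff lam (\<lambda>t. Re (g t)) n
        = sqrt (real n * (real n + 2 * lam)) * gegen_rcoeff lam (\<lambda>t. Re (f t)) n"
      "gegen_rcoeff lam (\<lambda>t. Im (g t)) n
        = sqrt (real n * (real n + 2 * lam)) * gegen_rcoeff lam (\<lambda>t. Im (f t)) n" if n: "n \<ge> 1" for n
  proof -
    have "real n + 2 * lam > 0" using n lam by (simp add: of_nat_le_iff[symmetric] del: of_nat_le_iff)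
    then have "(real n * (real n + 2 * lam)) powr (1 / 2) = sqrt (real n * (real n + 2 * lam))"
      by (intro powr_half_sqrt mult_nonneg_nonneg) auto
    then show "gegen_rcoeff lam (\<lambda>t. Re (g t)) n
        = sqrt (real n * (real n + 2 * lam)) * gegen_rcoeff lam (\<lambda>t. Re (f t)) n"
      "gegen_rcoeff lam (\<lambda>t. Im (g t)) n
        = sqrt (real n * (real n + 2 * lam)) * gegen_rcoeff lam (\<lambda>t. Im (f t)) n"
      using gn[OF n] unfolding fc gc by (auto simp: complex_eq_iff)
  qed
  let ?M = "gegen_measure lam"
  have "(LINT t|?M. (Re (f t))\<^sup>2) \<le> C * (LINT t|?M. (1 - t) * (Re (g t))\<^sup>2)"
    by (rule jacobi_hardy_imp_real_inequality[OF lam H C fparts(1) gparts(1)])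
      (use f0 g0 sq(1) in \<open>auto simp: fc gc complex_eq_iff\<close>)
  moreover have "(LINT t|?M. (Im (f t))\<^sup>2) \<le> C * (LINT t|?M. (1 - t) * (Im (g t))\<^sup>2)"
    by (rule jacobi_hardy_imp_real_inequality[OF lam H C fparts(2) gparts(2)])
      (use f0 g0 sq(2) in \<open>auto simp: fc gc complex_eq_iff\<close>)
  moreover have "gegen_const lam * (LINT t|lebesgue_on {-1..1}. (norm (f t))\<^sup>2 * gegen_weight lam t)
      = (LINT t|?M. (Re (f t))\<^sup>2) + (LINT t|?M. (Im (f t))\<^sup>2)"
    using weighted_norm_integral[OF lam f, of "\<lambda>_. 1" 1] by simp
  moreover have "gegen_const lam * (LINT t|lebesgue_on {-1..1}. (1 - t) * (norm (g t))\<^sup>2 * gegen_weight lam t)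
      = (LINT t|?M. (1 - t) * (Re (g t))\<^sup>2) + (LINT t|?M. (1 - t) * (Im (g t))\<^sup>2)"
    by (rule weighted_norm_integral[OF lam g, of _ 2]) (auto intro!: continuous_intros)
  ultimately have "gegen_const lam * (LINT t|lebesgue_on {-1..1}. (norm (f t))\<^sup>2 * gegen_weight lam t)
      \<le> gegen_const lam * (C * (LINT t|lebesgue_on {-1..1}. (1 - t) * (norm (g t))\<^sup>2 * gegen_weight lam t))"
    by (simp add: mult.left_commute distrib_left)
  then show "(LINT t|lebesgue_on {-1..1}. (norm (f t))\<^sup>2 * gegen_weight lam t)
      \<le> C * (LINT t|lebesgue_on {-1..1}. (1 - t) * (norm (g t))\<^sup>2 * gegen_weight lam t)"
    using gegen_const_pos[OF lam] by simp
qed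

lemma poly_in_L2_gegen:
  assumes lam: "lam > - 1 / 2"
  shows "(\<lambda>t. complex_of_real (poly p t)) \<in> L2_gegen lam"
proof -
  have pm[measurable]: "poly q \<in> borel_measurable (lebesgue_on {-1..1})" for q :: "real poly"
    by (rule continuous_imp_measurable_on_sets_lebesgue) (auto intro!: continuous_intros)
  have "integrable (gegen_measure lam) (poly (p * p))"
    by (rule integrable_poly_gegen_measure[OF lam])
  then have "integrable (lebesgue_on {-1..1}) (\<lambda>t. poly (p * p) t * gegen_weight lam t)"
    using gegen_measure_integral(1)[OF lam pm[of "p * p"]] by simp
  moreover have "(\<lambda>t. complex_of_real (poly p t)) \<in> borel_measurable (lebesgue_on {-1..1})"
    by measurable
  ultimately show ?thesis by (simp add: L2_gegen_def power2_eq_square)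
qed

text \<open>
  A finite sequence \<open>b\<close> is realized by the polynomial \<open>g = \<Sum> b\<^sub>n p\<^sub>n\<close> with
  \<open>f = \<Sum> b\<^sub>n / \<surd>(n (n + 2 \<lambda>)) p\<^sub>n\<close>.
\<close>

lemma gegen_ineq_imp_jacobi_hardy:
  assumes lam: "lam > - 1 / 2" and H: "gegen_ineq lam C"
  shows "jacobi_hardy lam C"
  unfolding jacobi_hardy_def
proof (intro allI)
  fix b :: "nat \<Rightarrow> real" and N :: nat
  let ?M = "gegen_measure lam"
  define a where "a n = b n / sqrt (real n * (real n + 2 * lam))" for n
  define f g where "f t = complex_of_real (poly (gegen_sum lam a N) t)"
    and "g t = complex_of_real (poly (gegen_sum lam b N) t)" for t
  have f: "f \<in> L2_gegen lam" and g: "g \<in> L2_gegen lam"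
    unfolding f_def[abs_def] g_def[abs_def] by (rule poly_in_L2_gegen[OF lam])+
  have rc: "gegen_rcoeff lam (poly (gegen_sum lam u N)) n = (if n \<in> {1..N} then u n else 0)" for u n
    using gegen_sum_coeff[OF lam, of u N n] by (simp add: gegen_rcoeff_def gegen_mean_def poly_mult[abs_def])
  have rc0: "gegen_rcoeff lam (\<lambda>t. 0) n = 0" for n by (simp add: gegen_rcoeff_def)
  have cf: "gegen_coeff lam f n = of_real (if n \<in> {1..N} then a n else 0)" for n
    using rc[of a n] rc0[of n] unfolding gegen_coeff_parts[OF lam f] by (simp add: f_def complex_eq_iff)
  have cg: "gegen_coeff lam g n = of_real (if n \<in> {1..N} then b n else 0)" for n
    using rc[of b n] rc0[of n] unfolding gegen_coeff_parts[OF lam g] by (simp add: g_def complex_eq_iff)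
  have pos: "real n * (real n + 2 * lam) > 0" if n: "n \<ge> 1" for n
  proof -
    have "real n \<ge> 1" using n by simp
    then show ?thesis using lam by (intro mult_pos_pos) linarith+
  qed
  have fg: "is_neg_gegen_op_powr lam (1 / 2) f g"
    unfolding is_neg_gegen_op_powr_def
  proof (intro conjI allI impI g)
    show "gegen_coeff lam g 0 = 0" by (simp add: cg)
    fix n :: nat assume n: "n \<ge> 1"
    have "(real n * (real n + 2 * lam)) powr (1 / 2) * a n = b n"
    proof -
      define s where "s = sqrt (real n * (real n + 2 * lam))"
      have "s > 0" unfolding s_def using pos[OF n] by (simp only: real_sqrt_gt_0_iff)
      moreover have "(real n * (real n + 2 * lam)) powr (1 / 2) = s"
        unfolding s_def by (rule powr_half_sqrt[OF less_imp_le[OF pos[OF n]]])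
      ultimately show ?thesis unfolding a_def s_def[symmetric] by simp
    qed
    then show "gegen_coeff lam g n
        = of_real ((real n * (real n + 2 * lam)) powr (1 / 2)) * gegen_coeff lam f n"
      unfolding cf cg by (auto simp flip: of_real_mult)
  qed
  have "gegen_coeff lam f 0 = 0" by (simp add: cf)
  then have mean0: "(LINT t|lebesgue_on {-1..1}. f t * of_real (gegen_weight lam t)) = 0"
    using gegen_const_pos[OF lam] by (simp add: gegen_coeff_def orthonormal_gegen_poly_0[OF lam])
  have "f \<in> L2_gegen lam \<inter> W2_gegen lam 1" using f fg by (auto simp: W2_gegen_def)
  with H mean0 fg have ineq: "(LINT t|lebesgue_on {-1..1}. (norm (f t))\<^sup>2 * gegen_weight lam t)
      \<le> C * (LINT t|lebesgue_on {-1..1}. (1 - t) * (norm (g t))\<^sup>2 * gegen_weight lam t)"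
    unfolding gegen_ineq_def by blast
  have "(LINT t|?M. (poly (gegen_sum lam a N) t)\<^sup>2) = (\<Sum>n=1..N. (a n)\<^sup>2)"
    using orthonormal_expansion_sqnorm[OF lam, of "{1..N}" a]
    by (simp add: gegen_mean_def gegen_sum_def power2_eq_square poly_mult[abs_def])
  also have "\<dots> = (\<Sum>n=1..N. (b n)\<^sup>2 / (real n * (real n + 2 * lam)))"
    using pos by (intro sum.cong refl) (simp add: a_def power_divide less_imp_le)
  finally have L: "gegen_const lam * (LINT t|lebesgue_on {-1..1}. (norm (f t))\<^sup>2 * gegen_weight lam t)
      = (\<Sum>n=1..N. (b n)\<^sup>2 / (real n * (real n + 2 * lam)))"
    using weighted_norm_integral[OF lam f, of "\<lambda>_. 1" 1] by (simp add: f_def)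
  have R: "gegen_const lam * (LINT t|lebesgue_on {-1..1}. (1 - t) * (norm (g t))\<^sup>2 * gegen_weight lam t)
      = jacobi_form lam b N"
    using weighted_norm_integral[OF lam g, of "\<lambda>t. 1 - t" 2] gegen_sum_jacobi_form[OF lam, of b N]
    by (simp add: g_def continuous_intros)
  have "gegen_const lam * (LINT t|lebesgue_on {-1..1}. (norm (f t))\<^sup>2 * gegen_weight lam t)
      \<le> gegen_const lam * (C * (LINT t|lebesgue_on {-1..1}. (1 - t) * (norm (g t))\<^sup>2 * gegen_weight lam t))"
    using ineq gegen_const_pos[OF lam] by (intro mult_left_mono) auto
  then show "(\<Sum>n=1..N. (b n)\<^sup>2 / (real n * (real n + 2 * lam))) \<le> C * jacobi_form lam b N"
    unfolding L mult.left_commute[of _ C] R .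
qed

theorem theorem3p4:
  fixes lam :: real
  assumes "lam > - 1 / 2"
  shows "(lam \<noteq> 1 / 2 \<longrightarrow> (\<exists>C>0. gegen_ineq lam C)) \<and>
         (0 \<le> lam \<and> lam \<le> 1 \<and> lam \<noteq> 1 / 2 \<longrightarrow>
            gegen_ineq lam (8 / (2 * lam - 1)\<^sup>2) \<and>
            (\<forall>C. gegen_ineq lam C \<longrightarrow> 8 / (2 * lam - 1)\<^sup>2 \<le> C)) \<and>
         (lam = 1 / 2 \<longrightarrow> \<not> (\<exists>C. gegen_ineq lam C))"
proof (intro conjI impI)
  have lower: "8 \<le> C * (2 * lam - 1)\<^sup>2" if "0 \<le> lam" "lam \<le> 1" "gegen_ineq lam C" for C
    using jacobi_hardy_constant_lower_bound gegen_ineq_imp_jacobi_hardy[OF assms] that by blast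
  show "\<exists>C>0. gegen_ineq lam C" if "lam \<noteq> 1 / 2"
    using jacobi_hardy_exists[OF assms that] jacobi_hardy_imp_gegen_ineq[OF assms] less_imp_le by blast
  show "\<not> (\<exists>C. gegen_ineq lam C)" if "lam = 1 / 2"
  proof clarify
    fix C assume "gegen_ineq lam C"
    moreover have "0 \<le> lam" "lam \<le> 1" "2 * lam - 1 = 0" using that by auto
    ultimately show False using lower[of C] by simp
  qed
  assume lam: "0 \<le> lam \<and> lam \<le> 1 \<and> lam \<noteq> 1 / 2"
  then show "gegen_ineq lam (8 / (2 * lam - 1)\<^sup>2)"
    by (intro jacobi_hardy_imp_gegen_ineq[OF assms] jacobi_hardy_optimal_constant) auto
  have pos: "(2 * lam - 1)\<^sup>2 > 0" using lam by auto
  show "\<forall>C. gegen_ineq lam C \<longrightarrow> 8 / (2 * lam - 1)\<^sup>2 \<le> C"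
    using lower lam by (simp add: pos_divide_le_eq[OF pos])
qed

end
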